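(* Let $\lambda=(\lambda_{31},\lambda_{32},\lambda_{33})$ be a highest weight of $sl_3$, $V_\lambda$ the corresponding irreducible representation with Gelfand--Tsetlin basis $(\xi_\Lambda)_{\Lambda\in\mathcal P_\lambda}$. Let $T=\begin{pmatrix}1&0&0\\0&0&1\\0&-1&0\end{pmatrix}\in SO(3)$ and let $\tau$ be the operator on $V_\lambda$ representing $T^{-1}$, with matrix elements defined by $\tau\,\xi_\Lambda=\sum_{\Lambda'\in\mathcal P_\lambda}\tau_{\Lambda'\Lambda}\,\xi_{\Lambda'}$. Then, up to a global sign (i.e. there is $\varepsilon\in\{1,-1\}$, independent of $\Lambda,\Lambda'$, by which the right-hand side has to be multiplied), for all $\Lambda=(\lambda_{11},\lambda_{21},\lambda_{22})$ and $\Lambda'=(\lambda'_{11},\lambda'_{21},\lambda'_{22})$ in $\mathcal P_\lambda$, $$\begin{aligned}\tau_{\Lambda'\Lambda}=\ &\delta_{\lambda'_{11},\lambda_{11}}\,\delta_{\lambda_{21}+\lambda_{22},\,\lambda'_{11}-\lambda'_{21}-\lambda'_{22}}\;t(\lambda'_{21},\lambda'_{11},\lambda'_{22})\,(-1)^{\lambda'_{22}-\lambda_{21}}\\ &\times\widetilde R_{\lambda_{31}-\lambda_{21}}\big(\lambda_{31}-\lambda'_{21};\ \lambda_{32}-\lambda_{31}-1,\ \lambda_{21}+\lambda_{22}+\lambda_{33}-1,\ \lambda_{11}-\lambda_{31}-1,\ -\lambda_{21}-\lambda_{22}-\lambda_{31}-1\big),\end{aligned}$$ where $$t(x,y,z)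=(x-z+1)\frac{(\lambda_{31}-\lambda_{32})!\,(\lambda_{31}-\lambda_{33}+1)!\,(\lambda_{31}-y)!\,(\lambda_{32}-z)!\,(y-z)!}{(x-\lambda_{32})!\,(x-\lambda_{33}+1)!\,(x-y)!\,(\lambda_{31}-z+1)!\,(\lambda_{31}-x)!\,(z-\lambda_{33})!}.$$
   Context: **Representation.** $sl_3$ is the complex Lie algebra of traceless $3\times3$ matrices; $e_{ij}=E_{ij}-\frac{\delta_{ij}}{3}I$ for $1\le i,j\le 3$, with $E_{ij}$ the matrix units. A highest weight is $\lambda=(\lambda_{31},\lambda_{32},\lambda_{33})$ with $\lambda_{31}-\lambda_{32},\lambda_{32}-\lambda_{33}\in\mathbb Z_{\ge0}$ and $\lambda_{31}+\lambda_{32}+\lambda_{33}=0$. The set $\mathcal P_\lambda$ of Gelfand--Tsetlin (GT) patterns consists of the triples $\Lambda=(\lambda_{11},\lambda_{21},\lambda_{22})$ such that $\lambda_{31}-\lambda_{21}$, $\lambda_{21}-\lambda_{32}$, $\lambda_{32}-\lambda_{22}$, $\lambda_{22}-\lambda_{33}$, $\lambda_{21}-\lambda_{11}$, $\lambda_{11}-\lambda_{22}$ all lie in $\mathbb Z_{\ge0}$. $V_\lambda$ is the irreducible $sl_3$-module with basis $(\xi_\Lambda)_{\Lambda\in\mathcal P_\lambda}$ and action $e_{11}\xi_\Lambda=\lambda_{11}\xi_\Lambda$, $e_{22}\xi_\Lambda=(\lambda_{21}+\lambda_{22}-\lambda_{11})\xi_\Lambda$, $e_{33}\xi_\Lambda=-(\lambda_{21}+\lambda_{22})\xi_\Lambda$,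 $e_{12}\xi_\Lambda=(\lambda_{21}-\lambda_{11})(\lambda_{11}-\lambda_{22}+1)\xi_{\Lambda+\delta^{11}}$, $e_{21}\xi_\Lambda=\xi_{\Lambda-\delta^{11}}$, $e_{23}\xi_\Lambda=\frac{\lambda_{31}-\lambda_{21}}{\lambda_{21}-\lambda_{22}+1}\xi_{\Lambda+\delta^{21}}+\frac{\lambda_{31}-\lambda_{22}+1}{\lambda_{21}-\lambda_{22}+1}\xi_{\Lambda+\delta^{22}}$, $e_{32}\xi_\Lambda=\frac{(\lambda_{21}-\lambda_{32})(\lambda_{21}-\lambda_{33}+1)(\lambda_{21}-\lambda_{11})}{\lambda_{21}-\lambda_{22}+1}\xi_{\Lambda-\delta^{21}}+\frac{(\lambda_{11}-\lambda_{22}+1)(\lambda_{32}-\lambda_{22}+1)(\lambda_{22}-\lambda_{33})}{\lambda_{21}-\lambda_{22}+1}\xi_{\Lambda-\delta^{22}}$, $e_{13}=[e_{12},e_{23}]$, $e_{31}=[e_{32},e_{21}]$, where $\Lambda\pm\delta^{ij}$ means $\lambda_{ij}$ replaced by $\lambda_{ij}\pm1$ and $\xi_{\Lambda\pm\delta^{ij}}=0$ if the result is not in $\mathcal P_\lambda$. **Rotations.** $V_\lambda$ integrates to a representation $\pi$ of $SL_3(\mathbb C)\supset SO(3)$. The operator representing $T^{-1}$ is $\tau=\pi(T^{-1})$; thus $\tau^{-1}g\,\tau=TgT^{-1}$ (as operators on $V_\lambda$) for $g\in sl_3$. **Racah polynomials.** $\widetilde R_n(x;\alpha,\beta,\gamma,\delta)={}_4F_3\left({-n,\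 n+\alpha+\beta+1,\ -x,\ x+\gamma+\delta+1\atop \alpha+1,\ \beta+\delta+1,\ \gamma+1}\Big|1\right)$, the finite sum over $0\le k\le\min(n,x)$; by convention it is $0$ if $n$ or $x$ is outside $\{0,\dots,N\}$ with $N=\min(-\alpha-1,-\beta-\delta-1,-\gamma-1)$. When a Kronecker delta vanishes the whole right-hand side is $0$. *)

theory Defs
  imports "HOL-Analysis.Analysis"
begin

section \<open>Gelfand--Tsetlin patterns\<close>

text \<open>
  A weight is a triple \<open>(\<lambda>31, \<lambda>32, \<lambda>33)\<close> and a pattern a triple \<open>(\<lambda>11, \<lambda>21, \<lambda>22)\<close>.  The entries
  are not integers in general: they only have integer differences and are determined by the
  condition that the entries of the weight sum to zero, so they lie in one third of the integers.
\<close>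

type_synonym weight = "real \<times> real \<times> real"
type_synonym pattern = "real \<times> real \<times> real"

fun highest_weight :: "weight \<Rightarrow> bool" where
  "highest_weight (l31, l32, l33) \<longleftrightarrow>
     l31 - l32 \<in> \<nat> \<and> l32 - l33 \<in> \<nat> \<and> l31 + l32 + l33 = 0"

fun gt_patterns :: "weight \<Rightarrow> pattern set" where
  "gt_patterns (l31, l32, l33) =
     {(l11, l21, l22).
        l31 - l21 \<in> \<nat> \<and> l21 - l32 \<in> \<nat> \<and> l32 - l22 \<in> \<nat> \<and> l22 - l33 \<in> \<nat> \<and>
        l21 - l11 \<in> \<nat> \<and> l11 - l22 \<in> \<nat>}"

lemma finite_gt_patterns: "finite (gt_patterns l)"
proof -
  obtain l31 l32 l33 where l: "l = (l31, l32, l33)" by (cases l) auto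
  let ?N = "{..nat \<lceil>l31 - l33\<rceil>}"
  let ?f = "\<lambda>(i, j, k). (l31 - real i - real k, l31 - real i, l32 - real j)"
  have "gt_patterns l \<subseteq> ?f ` (?N \<times> ?N \<times> ?N)"
  proof
    fix L assume L: "L \<in> gt_patterns l"
    obtain a b c where abc: "L = (a, b, c)" by (cases L) auto
    have nn: "0 \<le> x" if "x \<in> \<nat>" for x :: real using that by (auto elim: Nats_cases)
    have m: "l31 - b \<in> \<nat>" "b - l32 \<in> \<nat>" "l32 - c \<in> \<nat>" "c - l33 \<in> \<nat>" "b - a \<in> \<nat>" "a - c \<in> \<nat>"
      using L by (auto simp: l abc)
    obtain i j k where ijk: "l31 - b = real i" "l32 - c = real j" "b - a = real k"
      using m by (metis Nats_cases)
    have "real i \<le> l31 - l33" "real j \<le> l31 - l33" "real k \<le> l31 - l33"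
      using m[THEN nn] ijk by linarith+
    then have "i \<in> ?N" "j \<in> ?N" "k \<in> ?N" by (simp_all, linarith+)
    moreover have "L = ?f (i, j, k)" using ijk by (simp add: abc)
    ultimately show "L \<in> ?f ` (?N \<times> ?N \<times> ?N)" by blast
  qed
  then show ?thesis by (rule finite_subset) auto
qed


section \<open>The module with its Gelfand--Tsetlin basis\<close>

text \<open>
  Vectors are coordinate functions with respect to the basis, i.e. complex-valued functions
  vanishing outside the finite set of patterns.  The vector \<open>gt_xi l L\<close> is zero if \<open>L\<close> is not a
  pattern, which is the convention used in the formulas for the action.
\<close>

type_synonym gtvec = "pattern \<Rightarrow> complex"

definition gt_space :: "weight \<Rightarrow> gtvec set" where
  "gt_space l = {v. \<forall>M. M \<notin> gt_patterns l \<longrightarrow> v M = 0}"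

definition gt_xi :: "weight \<Rightarrow> pattern \<Rightarrow> gtvec" where
  "gt_xi l L = (\<lambda>M. if M = L \<and> L \<in> gt_patterns l then 1 else 0)"

definition lin_ext :: "weight \<Rightarrow> (pattern \<Rightarrow> gtvec) \<Rightarrow> gtvec \<Rightarrow> gtvec" where
  "lin_ext l f v = (\<lambda>M. \<Sum>L\<in>gt_patterns l. v L * f L M)"

definition e11 :: "weight \<Rightarrow> gtvec \<Rightarrow> gtvec" where
  "e11 l = lin_ext l (\<lambda>(l11, l21, l22) M. of_real l11 * gt_xi l (l11, l21, l22) M)"

definition e22 :: "weight \<Rightarrow> gtvec \<Rightarrow> gtvec" where
  "e22 l = lin_ext l (\<lambda>(l11, l21, l22) M. of_real (l21 + l22 - l11) * gt_xi l (l11, l21, l22) M)"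

definition e33 :: "weight \<Rightarrow> gtvec \<Rightarrow> gtvec" where
  "e33 l = lin_ext l (\<lambda>(l11, l21, l22) M. of_real (- (l21 + l22)) * gt_xi l (l11, l21, l22) M)"

definition e12 :: "weight \<Rightarrow> gtvec \<Rightarrow> gtvec" where
  "e12 l = lin_ext l (\<lambda>(l11, l21, l22) M.
     of_real ((l21 - l11) * (l11 - l22 + 1)) * gt_xi l (l11 + 1, l21, l22) M)"

definition e21 :: "weight \<Rightarrow> gtvec \<Rightarrow> gtvec" where
  "e21 l = lin_ext l (\<lambda>(l11, l21, l22) M. gt_xi l (l11 - 1, l21, l22) M)"

fun e23 :: "weight \<Rightarrow> gtvec \<Rightarrow> gtvec" where
  "e23 (l31, l32, l33) = lin_ext (l31, l32, l33) (\<lambda>(l11, l21, l22) M.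
     of_real ((l31 - l21) / (l21 - l22 + 1)) * gt_xi (l31, l32, l33) (l11, l21 + 1, l22) M
   + of_real ((l31 - l22 + 1) / (l21 - l22 + 1)) * gt_xi (l31, l32, l33) (l11, l21, l22 + 1) M)"

fun e32 :: "weight \<Rightarrow> gtvec \<Rightarrow> gtvec" where
  "e32 (l31, l32, l33) = lin_ext (l31, l32, l33) (\<lambda>(l11, l21, l22) M.
     of_real ((l21 - l32) * (l21 - l33 + 1) * (l21 - l11) / (l21 - l22 + 1))
       * gt_xi (l31, l32, l33) (l11, l21 - 1, l22) M
   + of_real ((l11 - l22 + 1) * (l32 - l22 + 1) * (l22 - l33) / (l21 - l22 + 1))
       * gt_xi (l31, l32, l33) (l11, l21, l22 - 1) M)"

definition e13 :: "weight \<Rightarrow> gtvec \<Rightarrow> gtvec" where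
  "e13 l v = (\<lambda>M. e12 l (e23 l v) M - e23 l (e12 l v) M)"

definition e31 :: "weight \<Rightarrow> gtvec \<Rightarrow> gtvec" where
  "e31 l v = (\<lambda>M. e32 l (e21 l v) M - e21 l (e32 l v) M)"

text \<open>
  A traceless matrix \<open>X\<close> equals the sum of all \<open>X $ i $ j\<close> times \<open>e\<^sub>i\<^sub>j\<close>, where
  \<open>e\<^sub>i\<^sub>j = E\<^sub>i\<^sub>j - (\<delta>\<^sub>i\<^sub>j / 3) I\<close>: the multiples of the identity add up to \<open>- (trace X / 3) I = 0\<close>.
\<close>

definition gt_action :: "weight \<Rightarrow> complex^3^3 \<Rightarrow> gtvec \<Rightarrow> gtvec" where
  "gt_action l X v = (\<lambda>M.
       X $ 1 $ 1 * e11 l v M + X $ 1 $ 2 * e12 l v M + X $ 1 $ 3 * e13 l v M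
     + X $ 2 $ 1 * e21 l v M + X $ 2 $ 2 * e22 l v M + X $ 2 $ 3 * e23 l v M
     + X $ 3 $ 1 * e31 l v M + X $ 3 $ 2 * e32 l v M + X $ 3 $ 3 * e33 l v M)"


section \<open>The integrated representation\<close>

definition SL3 :: "(complex^3^3) set" where
  "SL3 = {A. det A = 1}"

definition sl3 :: "(complex^3^3) set" where
  "sl3 = {X. trace X = 0}"

definition SL3_representation :: "weight \<Rightarrow> (complex^3^3 \<Rightarrow> gtvec \<Rightarrow> gtvec) \<Rightarrow> bool" where
  "SL3_representation l \<pi> \<longleftrightarrow>
     (\<forall>A\<in>SL3. \<forall>v\<in>gt_space l. \<pi> A v \<in> gt_space l) \<and>
     (\<forall>A\<in>SL3. \<forall>a b. \<forall>u\<in>gt_space l. \<forall>v\<in>gt_space l.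
        \<pi> A (\<lambda>M. a * u M + b * v M) = (\<lambda>M. a * \<pi> A u M + b * \<pi> A v M)) \<and>
     (\<forall>v\<in>gt_space l. \<pi> (mat 1) v = v) \<and>
     (\<forall>A\<in>SL3. \<forall>B\<in>SL3. \<forall>v\<in>gt_space l. \<pi> (A ** B) v = \<pi> A (\<pi> B v))"

text \<open>
  The representation \<open>\<pi>\<close> of the group integrates the representation of the Lie algebra if its
  differential at the identity is \<open>gt_action\<close>: along every curve in the group through the identity
  with velocity \<open>X\<close> there, the derivative of \<open>\<pi> v\<close> is \<open>gt_action l X v\<close>.  The velocity is
  automatically traceless.  The derivative in the finite-dimensional space of vectors is taken
  coordinatewise.  As the group is connected, this determines \<open>\<pi>\<close> on the group.
\<close>

definition integrates_gt_action :: "weight \<Rightarrow> (complex^3^3 \<Rightarrow> gtvec \<Rightarrow> gtvec) \<Rightarrow> bool" where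
  "integrates_gt_action l \<pi> \<longleftrightarrow>
     SL3_representation l \<pi> \<and>
     (\<forall>\<gamma> :: real \<Rightarrow> complex^3^3. \<forall>X\<in>sl3.
        (\<forall>s. \<gamma> s \<in> SL3) \<longrightarrow> \<gamma> 0 = mat 1 \<longrightarrow> (\<gamma> has_vector_derivative X) (at 0) \<longrightarrow>
        (\<forall>v\<in>gt_space l. \<forall>M\<in>gt_patterns l.
           ((\<lambda>s. \<pi> (\<gamma> s) v M) has_vector_derivative gt_action l X v M) (at 0)))"

definition T_rot :: "complex^3^3" where
  "T_rot = vector [vector [1, 0, 0], vector [0, 0, 1], vector [0, -1, 0]]"


section \<open>Racah polynomials and the normalising factor\<close>

text \<open>
  The polynomial is set to zero unless \<open>n\<close> and \<open>x\<close> are integers between \<open>0\<close> and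
  \<open>min (- \<alpha> - 1) (- \<beta> - \<delta> - 1) (- \<gamma> - 1)\<close>; in this range no denominator vanishes.
\<close>

definition racah_R :: "real \<Rightarrow> real \<Rightarrow> real \<Rightarrow> real \<Rightarrow> real \<Rightarrow> real \<Rightarrow> real" where
  "racah_R n x \<alpha> \<beta> \<gamma> \<delta> =
     (let N = min (- \<alpha> - 1) (min (- \<beta> - \<delta> - 1) (- \<gamma> - 1)) in
      if n \<in> \<nat> \<and> n \<le> N \<and> x \<in> \<nat> \<and> x \<le> N
      then \<Sum>k\<le>nat \<lfloor>min n x\<rfloor>.
             (pochhammer (- n) k * pochhammer (n + \<alpha> + \<beta> + 1) k *
              pochhammer (- x) k * pochhammer (x + \<gamma> + \<delta> + 1) k) /
             (pochhammer (\<alpha> + 1) k * pochhammer (\<beta> + \<delta> + 1) k * pochhammer (\<gamma> + 1) k * fact k)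
      else 0)"

text \<open>Only used at real numbers that are nonnegative integers.\<close>

definition rfact :: "real \<Rightarrow> real" where
  "rfact x = fact (nat \<lfloor>x\<rfloor>)"

fun t_coeff :: "weight \<Rightarrow> real \<Rightarrow> real \<Rightarrow> real \<Rightarrow> real" where
  "t_coeff (l31, l32, l33) x y z =
     (x - z + 1) *
     ((rfact (l31 - l32) * rfact (l31 - l33 + 1) * rfact (l31 - y) * rfact (l32 - z) * rfact (y - z)) /
      (rfact (x - l32) * rfact (x - l33 + 1) * rfact (x - y) * rfact (l31 - z + 1) *
       rfact (l31 - x) * rfact (z - l33)))"

end

theory Submission
  imports Defs
begin

text \<open>
  Conjugation by \<open>T\<^sup>-\<^sup>1\<close> permutes the root vectors up to sign, so that the operator \<open>\<tau>\<close> satisfies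
  \<open>\<tau> e\<^sub>2\<^sub>1 = e\<^sub>3\<^sub>1 \<tau>\<close>, \<open>\<tau> e\<^sub>3\<^sub>1 = - e\<^sub>2\<^sub>1 \<tau>\<close> and \<open>\<tau> e\<^sub>3\<^sub>2 = - e\<^sub>2\<^sub>3 \<tau>\<close>.  The module is generated by
  \<open>e\<^sub>2\<^sub>1\<close> and \<open>e\<^sub>3\<^sub>1\<close> from the eigenspace of \<open>e\<^sub>1\<^sub>1\<close> for the largest eigenvalue \<open>\<lambda>\<^sub>3\<^sub>1\<close>, which is an
  irreducible module of the subalgebra \<open>sl\<^sub>2\<close> in the indices 2 and 3.  On it \<open>\<tau>\<close> is determined by
  \<open>e\<^sub>3\<^sub>2\<close> up to a scalar, and the scalar is \<open>\<plusminus>1\<close> because \<open>\<tau>\<^sup>2\<close> represents \<open>diag (1, -1, -1)\<close>, which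
  lies on a one-parameter subgroup of the torus.  Descending induction on \<open>\<lambda>\<^sub>1\<^sub>1\<close> then determines all
  matrix elements.  It needs two relations between them, which are contiguous relations for Racah
  polynomials: one holds term by term in the hypergeometric sums, the other one follows by comparing
  coefficients of \<open>(-x)\<^sub>k (x + \<gamma> + \<delta> + 1)\<^sub>k\<close>.
\<close>

section \<open>Contiguous relations for Racah polynomials\<close>

text \<open>Pascal's rule turns the sum for \<open>Suc n\<close> and \<open>p\<close> into the sum
  for \<open>n\<close> and the difference \<open>q\<close> of \<open>p\<close> and its shift by 1.
  Taking this difference lowers the degree, so induction on \<open>n\<close> applies; a constant
  \<open>p\<close> gives \<open>q = 0\<close>.\<close>

lemma alternating_binomial_sum_poly:
  fixes p :: "real poly"
  assumes "degree p < n"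
  shows "(\<Sum>k\<le>n. (-1) ^ k * real (n choose k) * poly p (real k)) = 0"
  using assms
proof (induction n arbitrary: p)
  case (Suc n)
  define q where "q = p - pcompose p [:1, 1:]"
  have q: "poly q x = poly p x - poly p (1 + x)" for x
    by (simp add: q_def poly_pcompose)
  have "(\<Sum>k\<le>Suc n. (-1) ^ k * real (Suc n choose k) * poly p (real k)) =
        poly p 0 + (\<Sum>k\<le>n. (-1) ^ Suc k * real (Suc n choose Suc k) * poly p (real (Suc k)))"
    by (subst sum.atMost_Suc_shift) simp
  also have "\<dots> = poly p 0 + (\<Sum>k\<le>n. (-1) ^ Suc k * real (n choose Suc k) * poly p (real (Suc k)))
      - (\<Sum>k\<le>n. (-1) ^ k * real (n choose k) * poly p (real (Suc k)))"
    by (simp add: algebra_simps sum.distrib sum_negf sum_subtractf)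
  also have "poly p 0 + (\<Sum>k\<le>n. (-1) ^ Suc k * real (n choose Suc k) * poly p (real (Suc k))) =
      (\<Sum>k\<le>Suc n. (-1) ^ k * real (n choose k) * poly p (real k))"
    by (simp add: sum.atMost_Suc_shift del: sum.atMost_Suc)
  also have "\<dots> = (\<Sum>k\<le>n. (-1) ^ k * real (n choose k) * poly p (real k))"
    by simp
  finally have *: "(\<Sum>k\<le>Suc n. (-1) ^ k * real (Suc n choose k) * poly p (real k)) =
      (\<Sum>k\<le>n. (-1) ^ k * real (n choose k) * poly q (real k))"
    by (simp add: q sum_subtractf algebra_simps)
  show ?case
  proof (cases "degree p = 0")
    case True
    then obtain c where "p = [:c:]" by (rule degree_eq_zeroE)
    then have "q = 0" by (simp add: q_def)
    then show ?thesis using * by simp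
  next
    case False
    \<comment> \<open>The shift preserves degree and leading coefficient, so the leading term
      cancels in \<open>q\<close>.\<close>
    have "degree (pcompose p [:1, 1:]) = degree p" by (simp add: degree_pcompose)
    moreover have "coeff (pcompose p [:1, 1:]) (degree p) = coeff p (degree p)"
      using lead_coeff_comp[of "[:1, 1:]" p] by (simp add: degree_pcompose)
    ultimately have "degree q < degree p"
      using False unfolding q_def
      by (metis degree_diff_le eq_iff_diff_eq_0 coeff_diff leading_coeff_0_iff
            degree_0 le_neq_implies_less order_refl not_gr_zero)
    then show ?thesis using * Suc by simp
  qed
qed simp

text \<open>After cross-multiplication both sides are the Pochhammer symbol of \<open>E\<close> of
  length \<open>k + c\<close>, split after \<open>k\<close> or after \<open>c\<close> factors. The
  right-hand side exhibits the quotient as a polynomial in \<open>k\<close> of degree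
  \<open>c\<close>.\<close>

lemma pochhammer_shift_ratio:
  fixes E :: "'a :: field_char_0"
  assumes "pochhammer E k \<noteq> 0" "pochhammer E c \<noteq> 0"
  shows "pochhammer (E + of_nat c) k / pochhammer E k = pochhammer (E + of_nat k) c / pochhammer E c"
  using pochhammer_product'[of E k c] pochhammer_product'[of E c k] assms
  by (simp add: field_simps add.commute)

lemma pochhammer_minus_nat_nonzero:
  "k \<le> m \<Longrightarrow> pochhammer (- real m) k \<noteq> 0"
  by (simp add: pochhammer_of_nat_eq_0_iff)

section \<open>Coefficients of Racah polynomials\<close>

text \<open>Coefficient of a Racah polynomial at \<open>pochhammer (- x) k * pochhammer (x +
  \<gamma> + \<delta> + 1) k\<close>, where \<open>s\<close>, \<open>a\<close>, \<open>w\<close>,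
  \<open>g\<close> stand for n + \<alpha> + \<beta> + 1, \<alpha> + 1, \<beta> + \<delta> + 1,
  \<gamma> + 1. It is free of x, so that polynomials in the same products can be compared
  coefficientwise.\<close>

definition racah_coeff :: "real \<Rightarrow> real \<Rightarrow> real \<Rightarrow> real \<Rightarrow> real \<Rightarrow> nat \<Rightarrow> real" where
  "racah_coeff n s a w g k =
     pochhammer (- n) k * pochhammer s k / (pochhammer a k * pochhammer w k * pochhammer g k * fact k)"

text \<open>Beyond \<open>min n x\<close> one of \<open>pochhammer (- n) k\<close> and
  \<open>pochhammer (- x) k\<close> vanishes. A range independent of x allows sums for different
  arguments to be combined termwise.\<close>

lemma racah_R_eq_sum:
  assumes "n \<in> \<nat>" "x \<in> \<nat>" "n \<le> real K"
    and "n \<le> - \<alpha> - 1" "n \<le> - \<beta> - \<delta> - 1" "n \<le> - \<gamma> - 1"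
    and "x \<le> - \<alpha> - 1" "x \<le> - \<beta> - \<delta> - 1" "x \<le> - \<gamma> - 1"
  shows "racah_R n x \<alpha> \<beta> \<gamma> \<delta> =
    (\<Sum>k\<le>K. racah_coeff n (n + \<alpha> + \<beta> + 1) (\<alpha> + 1) (\<beta> + \<delta> + 1) (\<gamma> + 1) k *
       (pochhammer (- x) k * pochhammer (x + \<gamma> + \<delta> + 1) k))"
proof -
  obtain m j where mj: "n = real m" "x = real j" using assms by (auto elim!: Nats_cases)
  have nat: "nat \<lfloor>min n x\<rfloor> = min m j" by (auto simp: mj min_def)
  have "racah_R n x \<alpha> \<beta> \<gamma> \<delta> =
     (\<Sum>k\<le>min m j. racah_coeff n (n + \<alpha> + \<beta> + 1) (\<alpha> + 1) (\<beta> + \<delta> + 1) (\<gamma> + 1) k *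
       (pochhammer (- x) k * pochhammer (x + \<gamma> + \<delta> + 1) k))"
    using assms unfolding racah_R_def Let_def nat
    by (auto simp: racah_coeff_def intro!: sum.cong)
  also have "\<dots> = (\<Sum>k\<le>K. racah_coeff n (n + \<alpha> + \<beta> + 1) (\<alpha> + 1) (\<beta> + \<delta> + 1) (\<gamma> + 1) k *
       (pochhammer (- x) k * pochhammer (x + \<gamma> + \<delta> + 1) k))"
    using assms(3) by (intro sum.mono_neutral_left)
      (auto simp: mj racah_coeff_def not_le pochhammer_of_nat_eq_0_iff min_def split: if_splits)
  finally show ?thesis .
qed

text \<open>The rule \<open>u * pochhammer (u + 1) k = pochhammer u k * (u + k)\<close> for u = -x,
  x + g + d and g produces a common factor. What remains is (g + k)(2x + g + d) = (x + g)(x + g + d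
  + k) + (x + d)(k - x).\<close>

lemma racah_coeff_lower:
  assumes "pochhammer g k \<noteq> 0" "pochhammer (g + 1) k \<noteq> 0"
  shows "g * (2 * x + g + d) * racah_coeff n s a w g k * (pochhammer (- x) k * pochhammer (x + g + d) k) =
     (x + g) * (x + g + d) * racah_coeff n s a w (g + 1) k *
        (pochhammer (- x) k * pochhammer (x + g + d + 1) k)
     - x * (x + d) * racah_coeff n s a w (g + 1) k *
        (pochhammer (1 - x) k * pochhammer (x + g + d) k)"
proof -
  have shift: "u * pochhammer (u + 1) k = pochhammer u k * (u + real k)" for u :: real
    by (metis pochhammer_rec pochhammer_Suc)
  have 1: "- x * pochhammer (1 - x) k = pochhammer (- x) k * (real k - x)"
    using shift[of "- x"] by (simp add: algebra_simps)
  have 2: "(x + g + d) * pochhammer (x + g + d + 1) k = pochhammer (x + g + d) k * (x + g + d + real k)"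
    by (rule shift)
  have 3: "g / pochhammer g k = (g + real k) / pochhammer (g + 1) k"
    using shift[of g] assms by (simp add: field_simps)
  define c where "c = pochhammer (- n) k * pochhammer s k / (pochhammer a k * pochhammer w k * fact k)"
  have c: "racah_coeff n s a w u k = c / pochhammer u k" for u
    by (simp add: racah_coeff_def c_def)
  let ?P = "pochhammer (- x) k * pochhammer (x + g + d) k"
  have "g * (2 * x + g + d) * racah_coeff n s a w g k * ?P =
      (g / pochhammer g k) * (2 * x + g + d) * c * ?P"
    by (simp add: c)
  also have "\<dots> = (g + real k) * (2 * x + g + d) * (c / pochhammer (g + 1) k) * ?P"
    by (simp add: 3)
  also have "\<dots> = (c / pochhammer (g + 1) k) *
      ((x + g) * (pochhammer (- x) k * (pochhammer (x + g + d) k * (x + g + d + real k)))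
       + (x + d) * ((pochhammer (- x) k * (real k - x)) * pochhammer (x + g + d) k))"
    by (simp add: algebra_simps)
  also have "\<dots> = (c / pochhammer (g + 1) k) *
      ((x + g) * (pochhammer (- x) k * ((x + g + d) * pochhammer (x + g + d + 1) k))
       + (x + d) * ((- x * pochhammer (1 - x) k) * pochhammer (x + g + d) k))"
    by (simp only: 1 2)
  also have "\<dots> = (x + g) * (x + g + d) * racah_coeff n s a w (g + 1) k *
        (pochhammer (- x) k * pochhammer (x + g + d + 1) k)
     - x * (x + d) * racah_coeff n s a w (g + 1) k *
        (pochhammer (1 - x) k * pochhammer (x + g + d) k)"
    unfolding c by (simp add: algebra_simps add_divide_distrib)
  finally show ?thesis .
qed

text \<open>Comparison of coefficients of index \<open>Suc k\<close> in
  \<open>racah_R_raise\<close>, with \<open>b\<close> and \<open>d\<close> for \<beta> and \<delta>.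
  All four coefficients are multiples of one quotient \<open>c\<close>, and a polynomial identity
  remains.\<close>

lemma racah_coeff_raise:
  assumes "pochhammer a (Suc k) \<noteq> 0" "pochhammer w (Suc k) \<noteq> 0" "pochhammer g (Suc k) \<noteq> 0"
    and s: "s = n + a + b" and w: "w = b + d + 1"
  shows "g * ((n + a) * (n + w) * racah_coeff (n + 1) s a w g (Suc k)
            - (n + b) * (n + a - 1 - d) * racah_coeff n (s - 1) a w g (Suc k)) =
         (2 * n + a + b) * (g * (real (Suc k) + d + 1) * racah_coeff n s a w g (Suc k)
            - racah_coeff n s a w (g + 1) k)"
proof -
  define A W G where AWG: "A = pochhammer a k" "W = pochhammer w k" "G = pochhammer (g + 1) k"
  define N S where NS: "N = pochhammer (- n) k" "S = pochhammer s k"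
  have nz: "A \<noteq> 0" "a + real k \<noteq> 0" "W \<noteq> 0" "w + real k \<noteq> 0" "G \<noteq> 0" "g \<noteq> 0"
    using assms(1-2) assms(3)[unfolded pochhammer_rec] by (auto simp: pochhammer_Suc AWG)
  have e: "pochhammer a (Suc k) = A * (a + k)" "pochhammer w (Suc k) = W * (w + k)"
    "pochhammer g (Suc k) = g * G" "pochhammer (- n) (Suc k) = N * (k - n)"
    "pochhammer s (Suc k) = S * (s + k)"
    by (simp_all add: AWG NS pochhammer_Suc flip: pochhammer_rec)
  have e': "pochhammer (- (n + 1)) (Suc k) = - (n + 1) * N" "pochhammer (s - 1) (Suc k) = (s - 1) * S"
    by (simp_all add: NS pochhammer_rec)
  define c where "c = N * S / (A * (a + k) * (W * (w + k)) * (g * G) * fact (Suc k))"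
  have r: "racah_coeff (n + 1) s a w g (Suc k) = c * (- (n + 1) * (s + k))"
    "racah_coeff n (s - 1) a w g (Suc k) = c * ((k - n) * (s - 1))"
    "racah_coeff n s a w g (Suc k) = c * ((k - n) * (s + k))"
    by (simp_all only: racah_coeff_def e e' c_def) (simp_all add: field_simps)
  have f: "fact (Suc k) = (real k + 1) * fact k" by simp
  have r4: "racah_coeff n s a w (g + 1) k = c * (g * (a + k) * (w + k) * (real k + 1))"
    using nz unfolding racah_coeff_def AWG[symmetric] NS[symmetric] c_def f
    by (simp add: divide_simps del: fact_Suc)
  have "(n + a) * (n + w) * (- (n + 1) * (s + k)) - (n + b) * (n + a - 1 - d) * ((k - n) * (s - 1)) =
      (2 * n + a + b) * ((real (Suc k) + d + 1) * ((k - n) * (s + k)) - (a + k) * (w + k) * (real k + 1))"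
    unfolding s w by (simp add: algebra_simps)
  then have "g * c * ((n + a) * (n + w) * (- (n + 1) * (s + k)) - (n + b) * (n + a - 1 - d) * ((k - n) * (s - 1))) =
      g * c * ((2 * n + a + b) * ((real (Suc k) + d + 1) * ((k - n) * (s + k)) - (a + k) * (w + k) * (real k + 1)))"
    by simp
  then show ?thesis unfolding r r4 by (simp add: algebra_simps)
qed

section \<open>The two contiguous relations\<close>

text \<open>Sum of \<open>racah_coeff_lower\<close> over k. The larger parameter \<gamma> = g on the
  right corresponds to the larger first pattern entry on the right of
  \<open>entry_lower\<close>.\<close>

lemma racah_R_lower:
  assumes "n \<in> \<nat>" "x \<in> \<nat>" "- g \<in> \<nat>"
    and "n \<le> - \<alpha> - 1" "n \<le> - \<beta> - \<delta> - 1" "n \<le> - g - 1"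
    and "x \<le> - \<alpha> - 1" "x \<le> - \<beta> - \<delta> - 1" "x \<le> - g"
  shows "g * (2 * x + g + \<delta>) * racah_R n x \<alpha> \<beta> (g - 1) \<delta> =
    (x + g) * (x + g + \<delta>) * racah_R n x \<alpha> \<beta> g \<delta>
    - x * (x + \<delta>) * racah_R n (x - 1) \<alpha> \<beta> g \<delta>"
proof -
  obtain K m j where K: "n = real K" and m: "g = - real m" and j: "x = real j"
    using assms(1-3) by (metis Nats_cases minus_equation_iff)
  have Km: "K < m" using assms(6) by (simp add: K m)
  let ?c = "racah_coeff n (n + \<alpha> + \<beta> + 1) (\<alpha> + 1) (\<beta> + \<delta> + 1)"
  let ?u = "\<lambda>k. pochhammer (- x) k * pochhammer (x + g + \<delta>) k"
  let ?v = "\<lambda>k. pochhammer (- x) k * pochhammer (x + g + \<delta> + 1) k"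
  let ?w = "\<lambda>k. pochhammer (1 - x) k * pochhammer (x + g + \<delta>) k"
  have R: "racah_R n x \<alpha> \<beta> (g - 1) \<delta> = (\<Sum>k\<le>K. ?c g k * ?u k)"
    by (subst racah_R_eq_sum[where K=K]) (use assms in \<open>auto simp: K algebra_simps\<close>)
  \<comment> \<open>At x = -g the argument is out of range and the polynomial is 0 by convention,
    whereas the sum need not vanish; the factor x + g covers this case.\<close>
  have R1: "(x + g) * racah_R n x \<alpha> \<beta> g \<delta> = (x + g) * (\<Sum>k\<le>K. ?c (g + 1) k * ?v k)"
  proof (cases "x = - g")
    case False
    then have "x \<le> - g - 1" using assms(9) by (simp add: j m)
    then show ?thesis
      by (subst racah_R_eq_sum[where K=K]) (use assms in \<open>auto simp: K algebra_simps\<close>)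
  qed simp
  \<comment> \<open>The factor x does the same at x = 0, where the argument x - 1 is
    negative.\<close>
  have R2: "x * racah_R n (x - 1) \<alpha> \<beta> g \<delta> = x * (\<Sum>k\<le>K. ?c (g + 1) k * ?w k)"
  proof (cases "x = 0")
    case False
    then have "x - 1 \<in> \<nat>" by (auto simp: j not_less intro!: Nats_diff)
    then show ?thesis
      by (subst racah_R_eq_sum[where K=K]) (use assms in \<open>auto simp: K algebra_simps\<close>)
  qed simp
  have "g * (2 * x + g + \<delta>) * (\<Sum>k\<le>K. ?c g k * ?u k) =
      (x + g) * (x + g + \<delta>) * (\<Sum>k\<le>K. ?c (g + 1) k * ?v k)
      - x * (x + \<delta>) * (\<Sum>k\<le>K. ?c (g + 1) k * ?w k)"
    unfolding sum_distrib_left sum_subtractf[symmetric]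
  proof (rule sum.cong[OF refl])
    fix k assume "k \<in> {..K}"
    moreover have "g + 1 = - real (m - 1)" using Km by (simp add: m of_nat_diff)
    ultimately have "pochhammer g k \<noteq> 0" "pochhammer (g + 1) k \<noteq> 0"
      using Km by (auto simp: m intro!: pochhammer_minus_nat_nonzero simp del: of_nat_diff)
    from racah_coeff_lower[OF this, of x \<delta> n "n + \<alpha> + \<beta> + 1" "\<alpha> + 1" "\<beta> + \<delta> + 1"]
    show "g * (2 * x + g + \<delta>) * (?c g k * ?u k) = (x + g) * (x + g + \<delta>) * (?c (g + 1) k * ?v k)
      - x * (x + \<delta>) * (?c (g + 1) k * ?w k)"
      by (simp only: mult.assoc)
  qed
  also have "\<dots> = (x + g + \<delta>) * ((x + g) * (\<Sum>k\<le>K. ?c (g + 1) k * ?v k))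
      - (x + \<delta>) * (x * (\<Sum>k\<le>K. ?c (g + 1) k * ?w k))"
    by (simp only: mult_ac)
  also have "\<dots> = (x + g) * (x + g + \<delta>) * racah_R n x \<alpha> \<beta> g \<delta>
    - x * (x + \<delta>) * racah_R n (x - 1) \<alpha> \<beta> g \<delta>"
    unfolding R1[symmetric] R2[symmetric] by (simp only: mult_ac)
  finally show ?thesis by (simp only: R)
qed

text \<open>The three polynomials share the value x + g + \<delta> + 1 of the second upper parameter
  containing x, so they expand in the same products \<open>?f k\<close>. Multiplication by (x + g)(x
  + \<delta> + 1) maps \<open>?f k\<close> to a combination of \<open>?f k\<close> and
  \<open>?f (Suc k)\<close>, and coefficients can be compared.\<close>

lemma racah_R_raise:
  assumes "n \<in> \<nat>" "x \<in> \<nat>" "- \<alpha> \<in> \<nat>" "- \<beta> - \<delta> \<in> \<nat>" "- g \<in> \<nat>"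
    and "n + 1 \<le> - \<alpha> - 1" "n + 1 \<le> - \<beta> - \<delta> - 1" "n + 1 \<le> - g"
    and "x \<le> - \<alpha> - 1" "x \<le> - \<beta> - \<delta> - 1" "x \<le> - g"
  shows "g * ((n + \<alpha> + 1) * (n + \<beta> + \<delta> + 1) * racah_R (n + 1) x \<alpha> (\<beta> - 1) (g - 1) (\<delta> + 1)
          - (n + \<beta>) * (n + \<alpha> - \<delta>) * racah_R n x \<alpha> (\<beta> - 1) (g - 1) (\<delta> + 1)) =
    (2 * n + \<alpha> + \<beta> + 1) * ((x + g) * (x + \<delta> + 1) * racah_R n x \<alpha> \<beta> g \<delta>)"
proof -
  obtain K m j where K: "n = real K" and m: "g = - real m" and j: "x = real j"
    using assms(1,2,5) by (metis Nats_cases minus_equation_iff)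
  obtain p r where p: "\<alpha> = - real p" and r: "- \<beta> - \<delta> = real r"
    using assms(3,4) by (metis Nats_cases minus_equation_iff)
  define a w s where aws: "a = \<alpha> + 1" "w = \<beta> + \<delta> + 1" "s = n + \<alpha> + \<beta> + 1"
  have nz: "pochhammer a k \<noteq> 0" "pochhammer w k \<noteq> 0" "pochhammer g k \<noteq> 0" if "k \<le> Suc K" for k
  proof -
    have "a = - real (p - 1)" "w = - real (r - 1)"
      using assms(6,7) r by (auto simp: aws p K of_nat_diff)
    moreover have "k \<le> p - 1" "k \<le> r - 1" "k \<le> m"
      using that assms(6-8) r by (auto simp: p m K)
    ultimately show "pochhammer a k \<noteq> 0" "pochhammer w k \<noteq> 0" "pochhammer g k \<noteq> 0"
      by (auto simp: m intro!: pochhammer_minus_nat_nonzero simp del: of_nat_diff)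
  qed
  let ?c = "racah_coeff n s a w"
  let ?f = "\<lambda>k. pochhammer (- x) k * pochhammer (x + g + \<delta> + 1) k"
  let ?D = "2 * n + \<alpha> + \<beta> + 1"
  have R1: "racah_R (n + 1) x \<alpha> (\<beta> - 1) (g - 1) (\<delta> + 1) =
      (\<Sum>k\<le>Suc K. racah_coeff (n + 1) s a w g k * ?f k)"
    by (subst racah_R_eq_sum[where K="Suc K"]) (use assms in \<open>auto simp: K aws algebra_simps\<close>)
  have R2: "racah_R n x \<alpha> (\<beta> - 1) (g - 1) (\<delta> + 1) =
      (\<Sum>k\<le>Suc K. racah_coeff n (s - 1) a w g k * ?f k)"
    by (subst racah_R_eq_sum[where K="Suc K"]) (use assms in \<open>auto simp: K aws algebra_simps\<close>)
  have R3: "(x + g) * racah_R n x \<alpha> \<beta> g \<delta> = (x + g) * (\<Sum>k\<le>K. ?c (g + 1) k * ?f k)"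
  proof (cases "x = - g")
    case False
    then have "x \<le> - g - 1" using assms(11) by (simp add: j m)
    then show ?thesis
      by (subst racah_R_eq_sum[where K=K]) (use assms in \<open>auto simp: K aws algebra_simps\<close>)
  qed simp
  have step: "(x + g) * (x + \<delta> + 1) * (?c (g + 1) k * ?f k) =
      g * (real k + \<delta> + 1) * ?c g k * ?f k - ?c (g + 1) k * ?f (Suc k)" if "k \<le> K" for k
  proof -
    have g: "g * pochhammer (g + 1) k = pochhammer g k * (g + real k)"
      by (metis pochhammer_rec pochhammer_Suc)
    moreover have "g \<noteq> 0" using assms(8) by (auto simp: K)
    ultimately have "pochhammer (g + 1) k \<noteq> 0" "pochhammer g k \<noteq> 0"
      using nz(3)[of "Suc k"] nz(3)[of k] that by (auto simp: pochhammer_Suc)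
    with g have c: "(g + real k) * ?c (g + 1) k = g * ?c g k"
      by (simp add: racah_coeff_def divide_simps)
    \<comment> \<open>The new factor (k - x)(x + g + \<delta> + 1 + k) of \<open>?f (Suc k)\<close>
      is (k + g)(k + \<delta> + 1) - (x + g)(x + \<delta> + 1).\<close>
    have f: "(x + g) * (x + \<delta> + 1) * ?f k = (real k + g) * (real k + \<delta> + 1) * ?f k - ?f (Suc k)"
      by (simp add: pochhammer_Suc algebra_simps)
    have "(x + g) * (x + \<delta> + 1) * (?c (g + 1) k * ?f k) = ?c (g + 1) k * ((x + g) * (x + \<delta> + 1) * ?f k)"
      by (simp only: mult_ac)
    also have "\<dots> = (real k + \<delta> + 1) * ((g + real k) * ?c (g + 1) k) * ?f k - ?c (g + 1) k * ?f (Suc k)"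
      unfolding f by (simp only: right_diff_distrib add_ac mult_ac)
    finally show ?thesis unfolding c by (simp only: mult_ac)
  qed
  have "(x + g) * (x + \<delta> + 1) * racah_R n x \<alpha> \<beta> g \<delta> =
      (\<Sum>k\<le>K. (x + g) * (x + \<delta> + 1) * (?c (g + 1) k * ?f k))"
  proof -
    have "(x + g) * (x + \<delta> + 1) * racah_R n x \<alpha> \<beta> g \<delta> =
        (x + \<delta> + 1) * ((x + g) * racah_R n x \<alpha> \<beta> g \<delta>)"
      by (simp only: mult_ac)
    also have "\<dots> = (x + \<delta> + 1) * ((x + g) * (\<Sum>k\<le>K. ?c (g + 1) k * ?f k))"
      by (simp only: R3)
    also have "\<dots> = (x + g) * (x + \<delta> + 1) * (\<Sum>k\<le>K. ?c (g + 1) k * ?f k)"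
      by (simp only: mult_ac)
    finally show ?thesis by (simp only: sum_distrib_left)
  qed
  also have "\<dots> = (\<Sum>k\<le>K. g * (real k + \<delta> + 1) * ?c g k * ?f k) - (\<Sum>k\<le>K. ?c (g + 1) k * ?f (Suc k))"
    by (simp add: step sum_subtractf)
  \<comment> \<open>The added term is zero, because n = K makes
    \<open>pochhammer (- n) (Suc K)\<close> vanish. Splitting off k = 0 then aligns both sums at
    \<open>?f (Suc k)\<close>.\<close>
  also have "(\<Sum>k\<le>K. g * (real k + \<delta> + 1) * ?c g k * ?f k) =
      (\<Sum>k\<le>Suc K. g * (real k + \<delta> + 1) * ?c g k * ?f k)"
    by (simp add: racah_coeff_def K pochhammer_of_nat_eq_0_iff del: of_nat_Suc)
  also have "\<dots> = g * (\<delta> + 1) + (\<Sum>k\<le>K. g * (real (Suc k) + \<delta> + 1) * ?c g (Suc k) * ?f (Suc k))"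
    by (subst sum.atMost_Suc_shift) (simp add: racah_coeff_def)
  also have "g * (\<delta> + 1) + (\<Sum>k\<le>K. g * (real (Suc k) + \<delta> + 1) * ?c g (Suc k) * ?f (Suc k))
      - (\<Sum>k\<le>K. ?c (g + 1) k * ?f (Suc k)) =
      g * (\<delta> + 1) + (\<Sum>k\<le>K. (g * (real (Suc k) + \<delta> + 1) * ?c g (Suc k) - ?c (g + 1) k) * ?f (Suc k))"
    by (simp only: left_diff_distrib sum_subtractf add_diff_eq)
  finally have rhs: "?D * ((x + g) * (x + \<delta> + 1) * racah_R n x \<alpha> \<beta> g \<delta>) =
      ?D * g * (\<delta> + 1) + (\<Sum>k\<le>K. ?D * (g * (real (Suc k) + \<delta> + 1) * ?c g (Suc k) - ?c (g + 1) k) * ?f (Suc k))"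
    by (simp only: distrib_left[of ?D] sum_distrib_left mult.assoc)
  have "g * ((n + \<alpha> + 1) * (n + \<beta> + \<delta> + 1) * racah_R (n + 1) x \<alpha> (\<beta> - 1) (g - 1) (\<delta> + 1)
          - (n + \<beta>) * (n + \<alpha> - \<delta>) * racah_R n x \<alpha> (\<beta> - 1) (g - 1) (\<delta> + 1)) =
     (\<Sum>k\<le>Suc K. g * ((n + a) * (n + w) * racah_coeff (n + 1) s a w g k
            - (n + \<beta>) * (n + a - 1 - \<delta>) * racah_coeff n (s - 1) a w g k) * ?f k)"
    unfolding R1 R2 sum_distrib_left sum_subtractf[symmetric]
    by (intro sum.cong refl) (simp add: aws algebra_simps)
  \<comment> \<open>At index 0 all coefficients are 1, and (n + a)(n + w) - (n + \<beta>)(n + a - 1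
    - \<delta>) = \<open>?D\<close> (\<delta> + 1).\<close>
  also have "\<dots> = ?D * g * (\<delta> + 1) +
     (\<Sum>k\<le>K. g * ((n + a) * (n + w) * racah_coeff (n + 1) s a w g (Suc k)
            - (n + \<beta>) * (n + a - 1 - \<delta>) * racah_coeff n (s - 1) a w g (Suc k)) * ?f (Suc k))"
    by (subst sum.atMost_Suc_shift) (simp add: racah_coeff_def aws algebra_simps)
  also have "(\<Sum>k\<le>K. g * ((n + a) * (n + w) * racah_coeff (n + 1) s a w g (Suc k)
            - (n + \<beta>) * (n + a - 1 - \<delta>) * racah_coeff n (s - 1) a w g (Suc k)) * ?f (Suc k)) =
     (\<Sum>k\<le>K. ?D * (g * (real (Suc k) + \<delta> + 1) * ?c g (Suc k) - ?c (g + 1) k) * ?f (Suc k))"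
  proof (intro sum.cong refl)
    fix k assume "k \<in> {..K}"
    then have "Suc k \<le> Suc K" by simp
    moreover have "?D = 2 * n + a + \<beta>" by (simp add: aws)
    ultimately show "g * ((n + a) * (n + w) * racah_coeff (n + 1) s a w g (Suc k)
            - (n + \<beta>) * (n + a - 1 - \<delta>) * racah_coeff n (s - 1) a w g (Suc k)) * ?f (Suc k) =
       ?D * (g * (real (Suc k) + \<delta> + 1) * ?c g (Suc k) - ?c (g + 1) k) * ?f (Suc k)"
      using racah_coeff_raise[of a k w g s n \<beta> \<delta>] nz[of "Suc k"]
      by (simp add: aws)
  qed
  finally show ?thesis using rhs by simp
qed

text \<open>
  As the upper parameter \<open>x + \<gamma> + \<delta> + 1\<close> cancels the lower parameter \<open>\<alpha> + 1\<close>, the sum is the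
  \<open>n\<close>-th finite difference of a polynomial of degree less than \<open>n\<close>.
\<close>

lemma racah_R_eq_0:
  assumes "n \<in> \<nat>" "x \<in> \<nat>" "- \<alpha> \<in> \<nat>" "- \<beta> - \<delta> \<in> \<nat>" "- \<gamma> \<in> \<nat>"
    and "n \<le> - \<alpha> - 1" "n \<le> - \<beta> - \<delta> - 1" "n \<le> - \<gamma> - 1"
    and "x \<le> - \<alpha> - 1" "x \<le> - \<beta> - \<delta> - 1" "x \<le> - \<gamma> - 1"
    and sum: "x + \<gamma> + \<delta> = \<alpha>"
    and c: "n + \<alpha> - \<delta> = real c" "c \<le> - \<beta> - \<delta> - 1" "c - \<gamma> - 1 - x < n"
  shows "racah_R n x \<alpha> \<beta> \<gamma> \<delta> = 0"
proof -
  obtain K m j where K: "n = real K" and m: "\<gamma> = - real m" and j: "x = real j"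
    using assms(1,2,5) by (metis Nats_cases minus_equation_iff)
  obtain p r where p: "\<alpha> = - real p" and r: "- \<beta> - \<delta> = real r"
    using assms(3,4) by (metis Nats_cases minus_equation_iff)
  define E where "E = \<beta> + \<delta> + 1"
  \<comment> \<open>Chosen so that -x = \<gamma> + 1 + d; the subtraction is not truncated because x
    \<le> -\<gamma> - 1.\<close>
  define d where "d = m - 1 - j"
  have E: "E = - real (r - 1)" "K \<le> r - 1" "c \<le> r - 1"
    using assms(7) r c by (auto simp: E_def K of_nat_diff)
  have g: "\<gamma> + 1 = - real (m - 1)" "K \<le> m - 1" "d \<le> m - 1" "- x = \<gamma> + 1 + real d"
    using assms(8,11) by (auto simp: m K j d_def of_nat_diff)
  have a: "\<alpha> + 1 = - real (p - 1)" "K \<le> p - 1"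
    using assms(6) by (auto simp: p K of_nat_diff)
  have "real c + real d < real K" using c(3) g(4) K by linarith
  then have cd: "c + d < K" by linarith
  \<comment> \<open>Up to constants, the values of \<open>P\<close> are the quotients of Pochhammer
    symbols with parameters E + c over E and \<gamma> + 1 + d over \<gamma> + 1, rewritten as
    polynomials in k.\<close>
  define P where "P = (\<Prod>i<c. [:E + real i, 1:]) * (\<Prod>i<d. [:\<gamma> + 1 + real i, 1:])"
  have "degree P \<le> c + d"
    unfolding P_def
    by (rule order.trans[OF degree_mult_le], rule add_mono; rule order.trans[OF degree_prod_sum_le]) auto
  then have deg: "degree P < K" using cd by simp
  have P: "poly P (real k) = pochhammer (E + real k) c * pochhammer (\<gamma> + 1 + real k) d" for k
    by (simp add: P_def poly_prod pochhammer_prod atLeast0LessThan algebra_simps)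
  have "racah_R n x \<alpha> \<beta> \<gamma> \<delta> =
    (\<Sum>k\<le>K. racah_coeff n (n + \<alpha> + \<beta> + 1) (\<alpha> + 1) E (\<gamma> + 1) k *
       (pochhammer (- x) k * pochhammer (\<alpha> + 1) k))"
    by (subst racah_R_eq_sum[where K=K]) (use assms in \<open>auto simp: K E_def\<close>)
  also have "\<dots> = (\<Sum>k\<le>K. (-1) ^ k * real (K choose k) * poly P (real k)
      / (pochhammer E c * pochhammer (\<gamma> + 1) d))"
  proof (rule sum.cong[OF refl])
    fix k assume "k \<in> {..K}"
    then have k: "k \<le> K" by simp
    have s: "n + \<alpha> + \<beta> + 1 = E + real c" using c by (simp add: E_def)
    have nz: "pochhammer E k \<noteq> 0" "pochhammer E c \<noteq> 0" "pochhammer (\<gamma> + 1) k \<noteq> 0"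
      "pochhammer (\<gamma> + 1) d \<noteq> 0" "pochhammer (\<alpha> + 1) k \<noteq> 0"
      using E g a k by (auto intro!: pochhammer_minus_nat_nonzero simp del: of_nat_diff)
    have b: "pochhammer (- n) k / fact k = (-1) ^ k * real (K choose k)"
      using gbinomial_pochhammer[of "real K" k]
      by (simp add: K binomial_gbinomial flip: power_mult_distrib)
    have "racah_coeff n (n + \<alpha> + \<beta> + 1) (\<alpha> + 1) E (\<gamma> + 1) k * (pochhammer (- x) k * pochhammer (\<alpha> + 1) k) =
       (pochhammer (- n) k / fact k) * (pochhammer (E + real c) k / pochhammer E k)
       * (pochhammer (\<gamma> + 1 + real d) k / pochhammer (\<gamma> + 1) k)"
      using nz by (simp add: racah_coeff_def s g(4) mult_ac)
    also have "\<dots> = (-1) ^ k * real (K choose k) * poly P (real k)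
      / (pochhammer E c * pochhammer (\<gamma> + 1) d)"
      unfolding b P pochhammer_shift_ratio[OF nz(1,2)] pochhammer_shift_ratio[OF nz(3,4)] by simp
    finally show "racah_coeff n (n + \<alpha> + \<beta> + 1) (\<alpha> + 1) E (\<gamma> + 1) k * (pochhammer (- x) k * pochhammer (\<alpha> + 1) k) =
       (-1) ^ k * real (K choose k) * poly P (real k) / (pochhammer E c * pochhammer (\<gamma> + 1) d)" .
  qed
  also have "\<dots> = 0"
    by (simp add: alternating_binomial_sum_poly[OF deg] flip: sum_divide_distrib)
  finally show ?thesis .
qed

section \<open>Relations between the matrix elements\<close>

lemma Nats_add_1: "y \<in> \<nat> \<Longrightarrow> w = y + 1 \<Longrightarrow> w \<in> \<nat>"
  for y :: real by simp

lemma Nats_minus_1: "y \<in> \<nat> \<Longrightarrow> y \<noteq> 0 \<Longrightarrow> w = y - 1 \<Longrightarrow> w \<in> \<nat>"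
  for y :: real by (auto elim!: Nats_cases intro!: Nats_diff simp: not_less)

lemma Nats_ge_0: "y \<in> \<nat> \<Longrightarrow> 0 \<le> y" for y :: real
  by (auto elim: Nats_cases)

lemma rfact_add_1: "y \<in> \<nat> \<Longrightarrow> w = y + 1 \<Longrightarrow> rfact w = w * rfact y"
proof (elim Nats_cases)
  fix n assume "w = y + 1" "y = real n"
  then have "nat \<lfloor>w\<rfloor> = Suc n" "nat \<lfloor>y\<rfloor> = n" by linarith+
  then show ?thesis using \<open>w = y + 1\<close> \<open>y = real n\<close> by (simp add: rfact_def)
qed

lemma rfact_nonzero [simp]: "rfact y \<noteq> 0"
  by (simp add: rfact_def)

lemma rfact_0 [simp]: "rfact 0 = 1"
  by (simp add: rfact_def)

lemma minus_one_powi_floor_add_1: "w = y + 1 \<Longrightarrow> (-1 :: real) powi \<lfloor>w\<rfloor> = - ((-1) powi \<lfloor>y\<rfloor>)"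
  by (simp add: power_int_add)

text \<open>The first pattern is the source \<Lambda>, the second the target \<Lambda>'; this order
  is opposite to that of the indices of \<open>\<tau>m\<close>.\<close>

fun gt_rotation_entry :: "weight \<Rightarrow> pattern \<Rightarrow> pattern \<Rightarrow> real" where
  "gt_rotation_entry (l31, l32, l33) (l11, l21, l22) (l11', l21', l22') =
     (if l11' = l11 \<and> l21 + l22 = l11' - l21' - l22' then
        t_coeff (l31, l32, l33) l21' l11' l22' *
        (-1) powi \<lfloor>l22' - l21\<rfloor> *
        racah_R (l31 - l21) (l31 - l21')
          (l32 - l31 - 1) (l21 + l22 + l33 - 1) (l11 - l31 - 1) (- l21 - l22 - l31 - 1)
      else 0)"

locale gt_weight =
  fixes l31 l32 l33 :: real
  assumes weight: "highest_weight (l31, l32, l33)"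
begin

abbreviation wt :: weight where "wt \<equiv> (l31, l32, l33)"
abbreviation P :: "pattern set" where "P \<equiv> gt_patterns wt"
abbreviation S :: "pattern \<Rightarrow> pattern \<Rightarrow> real" where "S \<equiv> gt_rotation_entry wt"

lemma weight_sum: "l33 = - l31 - l32"
  using weight by simp

lemma weight_Nats: "l31 - l32 \<in> \<nat>" "l32 - l33 \<in> \<nat>" "l31 - l33 \<in> \<nat>"
proof -
  show 1: "l31 - l32 \<in> \<nat>" and 2: "l32 - l33 \<in> \<nat>" using weight by simp_all
  show "l31 - l33 \<in> \<nat>" using Nats_add[OF 1 2] by simp
qed

lemma gt_pattern_Nats:
  assumes "(a, x, z) \<in> P"
  shows "l31 - x \<in> \<nat>" "x - l32 \<in> \<nat>" "l32 - z \<in> \<nat>" "z - l33 \<in> \<nat>" "x - a \<in> \<nat>" "a - z \<in> \<nat>"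
    and "l31 \<ge> x" "x \<ge> l32" "l32 \<ge> z" "z \<ge> l33" "x \<ge> a" "a \<ge> z"
    and "x - z \<in> \<nat>" "l31 - a \<in> \<nat>" "x - l33 \<in> \<nat>" "l31 - z \<in> \<nat>"
proof -
  show N: "l31 - x \<in> \<nat>" "x - l32 \<in> \<nat>" "l32 - z \<in> \<nat>" "z - l33 \<in> \<nat>" "x - a \<in> \<nat>" "a - z \<in> \<nat>"
    using assms by simp_all
  show "l31 \<ge> x" "x \<ge> l32" "l32 \<ge> z" "z \<ge> l33" "x \<ge> a" "a \<ge> z"
    using N[THEN Nats_ge_0] by simp_all
  show "x - z \<in> \<nat>" "l31 - a \<in> \<nat>" "x - l33 \<in> \<nat>" "l31 - z \<in> \<nat>"
    using Nats_add[OF N(5,6)] Nats_add[OF N(1,5)]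
      Nats_add[OF N(2) weight_Nats(2)] Nats_add[OF weight_Nats(1) N(3)] by simp_all
qed

section \<open>The normalising factor at neighbouring patterns\<close>

text \<open>The factor on the left is a coefficient of \<open>e31_apply\<close>, the one on the
  right a quotient of coefficients of \<open>racah_R_lower\<close>. Together with
  \<open>t_coeff_raise_22\<close> this converts the action of \<open>e31\<close> into the contiguous
  relation.\<close>

lemma t_coeff_raise_21:
  assumes P: "(a, x, z) \<in> P" and P': "(a + 1, x + 1, z) \<in> P"
  shows "(x + 1 - l32) * (x + 2 - l33) / (x - z + 2) * t_coeff wt (x + 1) (a + 1) z =
    (l31 - x) * (a + 1 - z) / ((x - z + 1) * (l31 - a)) * t_coeff wt x a z"
proof -
  note N = gt_pattern_Nats[OF P] and N' = gt_pattern_Nats[OF P']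
  have r: "rfact (l31 - a) = (l31 - a) * rfact (l31 - (a + 1))"
    "rfact (a + 1 - z) = (a + 1 - z) * rfact (a - z)"
    "rfact (x + 1 - l32) = (x + 1 - l32) * rfact (x - l32)"
    "rfact (x + 1 - l33 + 1) = (x + 2 - l33) * rfact (x - l33 + 1)"
    "rfact (l31 - x) = (l31 - x) * rfact (l31 - (x + 1))"
    using rfact_add_1[OF N'(14), of "l31 - a"] rfact_add_1[OF N(6), of "a + 1 - z"]
      rfact_add_1[OF N(2), of "x + 1 - l32"] rfact_add_1[OF N'(15), of "x + 1 - l33 + 1"]
      rfact_add_1[OF N'(1), of "l31 - x"]
    by (simp_all add: algebra_simps)
  have nz: "l31 - a \<noteq> 0" "x + 1 - l32 \<noteq> 0" "x + 2 - l33 \<noteq> 0" "l31 - x \<noteq> 0" "x - z + 1 \<noteq> 0"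
     "x - z + 2 \<noteq> 0" "x + 1 - z + 1 = x - z + 2" "x + 1 - (a + 1) = x - a"
    using N N' by (auto simp del: gt_patterns.simps)
  show ?thesis
    unfolding t_coeff.simps r nz(7,8) using nz(1-6) by (simp add: divide_simps)
qed

lemma t_coeff_raise_22:
  assumes P: "(a, x, z) \<in> P" and P': "(a + 1, x, z + 1) \<in> P"
  shows "(l32 - z) * (z + 1 - l33) / (x - z) * t_coeff wt x (a + 1) (z + 1) =
    (x - a) * (l31 - z + 1) / ((x - z + 1) * (l31 - a)) * t_coeff wt x a z"
proof -
  note N = gt_pattern_Nats[OF P] and N' = gt_pattern_Nats[OF P']
  have r: "rfact (l31 - a) = (l31 - a) * rfact (l31 - (a + 1))"
    "rfact (l32 - z) = (l32 - z) * rfact (l32 - (z + 1))"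
    "rfact (x - a) = (x - a) * rfact (x - (a + 1))"
    "rfact (l31 - z + 1) = (l31 - z + 1) * rfact (l31 - (z + 1) + 1)"
    "rfact (z + 1 - l33) = (z + 1 - l33) * rfact (z - l33)"
    using rfact_add_1[OF N'(14), of "l31 - a"] rfact_add_1[OF N'(3), of "l32 - z"]
      rfact_add_1[OF N'(5), of "x - a"] rfact_add_1[OF N(16), of "l31 - z + 1"]
      rfact_add_1[OF N(4), of "z + 1 - l33"]
    by (simp_all add: algebra_simps)
  have nz: "l31 - a \<noteq> 0" "l32 - z \<noteq> 0" "x - a \<noteq> 0" "l31 - z + 1 \<noteq> 0" "z + 1 - l33 \<noteq> 0"
     "x - z \<noteq> 0" "x - z + 1 \<noteq> 0" "x - (z + 1) + 1 = x - z" "a + 1 - (z + 1) = a - z"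
    using N N' by (auto simp del: gt_patterns.simps)
  show ?thesis
    unfolding t_coeff.simps r nz(8,9) using nz(1-7) by (simp add: divide_simps)
qed

text \<open>Only the first entry moves, as under \<open>e21\<close>; this serves the right-hand side
  of \<open>entry_raise\<close>.\<close>

lemma t_coeff_raise_11:
  assumes P: "(a, x, z) \<in> P" and P': "(a + 1, x, z) \<in> P"
  shows "(l31 - a) * t_coeff wt x (a + 1) z = (a + 1 - z) * (x - a) * t_coeff wt x a z"
proof -
  note N = gt_pattern_Nats[OF P] and N' = gt_pattern_Nats[OF P']
  have r: "rfact (l31 - a) = (l31 - a) * rfact (l31 - (a + 1))"
    "rfact (a + 1 - z) = (a + 1 - z) * rfact (a - z)"
    "rfact (x - a) = (x - a) * rfact (x - (a + 1))"
    using rfact_add_1[OF N'(14), of "l31 - a"] rfact_add_1[OF N(6), of "a + 1 - z"]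
      rfact_add_1[OF N'(5), of "x - a"]
    by (simp_all add: algebra_simps)
  have nz: "l31 - a \<noteq> 0" "x - a \<noteq> 0"
    using N N' by (auto simp del: gt_patterns.simps)
  show ?thesis
    unfolding t_coeff.simps r using nz by (simp add: divide_simps)
qed

section \<open>Recurrences between the matrix elements\<close>

text \<open>Matrix element of \<open>\<tau> e\<^sub>2\<^sub>1 = e\<^sub>3\<^sub>1 \<tau>\<close>
  from \<open>(a + 1, b, c)\<close> to \<open>(a, x, z)\<close>. The Kronecker conditions of the
  three entries agree, and once the factors t are compared the claim is
  \<open>racah_R_lower\<close>, the terms on the right having arguments X - 1 and X.\<close>

lemma entry_lower:
  assumes L: "(a + 1, b, c) \<in> P" and M: "(a, x, z) \<in> P"
  shows "S (a, b, c) (a, x, z) =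
      (x + 1 - l32) * (x + 2 - l33) / (x - z + 2) *
        (if (a + 1, x + 1, z) \<in> P then S (a + 1, b, c) (a + 1, x + 1, z) else 0)
    - (l32 - z) * (z + 1 - l33) / (x - z) *
        (if (a + 1, x, z + 1) \<in> P then S (a + 1, b, c) (a + 1, x, z + 1) else 0)"
proof (cases "b + c = a - x - z")
  case False
  then show ?thesis by simp
next
  case delta: True
  note N = gt_pattern_Nats[OF L] and N' = gt_pattern_Nats[OF M]
  define t s where "t = t_coeff wt x a z" and "s = (-1 :: real) powi \<lfloor>z - b\<rfloor>"
  define n X \<alpha> \<beta> g \<delta> where par: "n = l31 - b" "X = l31 - x" "\<alpha> = l32 - l31 - 1"
    "\<beta> = b + c + l33 - 1" "g = a - l31" "\<delta> = - b - c - l31 - 1"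
  have nz: "x - z + 1 \<noteq> 0" "l31 - a \<noteq> 0" using N N' by (auto simp del: gt_patterns.simps)
  have Na: "n \<in> \<nat>" "X \<in> \<nat>" "- \<alpha> \<in> \<nat>" "- \<beta> - \<delta> \<in> \<nat>" "- g \<in> \<nat>"
  proof -
    show "n \<in> \<nat>" "X \<in> \<nat>" "- g \<in> \<nat>" using N N' by (simp_all add: par del: gt_patterns.simps)
    show "- \<alpha> \<in> \<nat>" by (rule Nats_add_1[OF weight_Nats(1)]) (simp add: par)
    have "l31 - l33 + 1 \<in> \<nat>" by (rule Nats_add_1[OF weight_Nats(3)]) simp
    from Nats_add_1[OF this, of "- \<beta> - \<delta>"] show "- \<beta> - \<delta> \<in> \<nat>" by (simp add: par)
  qed
  have le: "n \<le> - \<alpha> - 1" "n \<le> - \<beta> - \<delta> - 1" "n \<le> - g - 1"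
     "X \<le> - \<alpha> - 1" "X \<le> - \<beta> - \<delta> - 1" "X \<le> - g"
    using N N' by (auto simp: par simp del: gt_patterns.simps)
  have S0: "S (a, b, c) (a, x, z) = t * s * racah_R n X \<alpha> \<beta> (g - 1) \<delta>"
    using delta by (simp add: t_def s_def par algebra_simps)
  have S1: "(x + 1 - l32) * (x + 2 - l33) / (x - z + 2) *
        (if (a + 1, x + 1, z) \<in> P then S (a + 1, b, c) (a + 1, x + 1, z) else 0) =
      (l31 - x) * (a + 1 - z) / ((x - z + 1) * (l31 - a)) * t * s * racah_R n (X - 1) \<alpha> \<beta> g \<delta>"
  \<comment> \<open>The neighbour fails to be a pattern only at x = l31, where the coefficient l31 -
    x is zero.\<close>
  proof (cases "x = l31")
    case True
    then have "(a + 1, x + 1, z) \<notin> P" using gt_pattern_Nats(7) by fastforce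
    then show ?thesis using True by (simp del: gt_patterns.simps)
  next
    case False
    then have P: "(a + 1, x + 1, z) \<in> P"
      using Nats_minus_1[OF N'(1), of "l31 - (x + 1)"] Nats_add_1[OF N'(2), of "x + 1 - l32"] N'
        Nats_add_1[OF N'(6), of "a + 1 - z"]
      by simp
    have "S (a + 1, b, c) (a + 1, x + 1, z) = t_coeff wt (x + 1) (a + 1) z * (s * racah_R n (X - 1) \<alpha> \<beta> g \<delta>)"
      using delta by (simp add: s_def par algebra_simps del: t_coeff.simps)
    then show ?thesis using t_coeff_raise_21[OF M P] P
      by (simp add: t_def del: t_coeff.simps gt_patterns.simps gt_rotation_entry.simps flip: mult.assoc)
  qed
  have S2: "(l32 - z) * (z + 1 - l33) / (x - z) *
        (if (a + 1, x, z + 1) \<in> P then S (a + 1, b, c) (a + 1, x, z + 1) else 0) =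
     - ((x - a) * (l31 - z + 1) / ((x - z + 1) * (l31 - a)) * t * s * racah_R n X \<alpha> \<beta> g \<delta>)"
  proof -
    consider "x = a" | "x \<noteq> a" "z = l32" | "x \<noteq> a" "z \<noteq> l32" by blast
    then show ?thesis
    proof cases
      case 1
      then have "(a + 1, x, z + 1) \<notin> P" using gt_pattern_Nats(11) by fastforce
      then show ?thesis using 1 by (simp del: gt_patterns.simps)
    next
      case 2
      \<comment> \<open>\<open>(a + 1, x, z + 1)\<close> is not a pattern, but \<open>racah_R_lower\<close> has a nonzero coefficient here.\<close>
      then have "X \<le> - g - 1"
        using Nats_ge_0[OF Nats_minus_1[OF N'(5), of "x - a - 1"]] by (simp add: par)
      \<comment> \<open>Here z = l32 gives X + g + \<delta> = \<alpha>, and n + \<alpha> - \<delta>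
        = c - l33 = k. The degree bound k - g - 1 - X equals n - 1, just small enough for
        \<open>racah_R_eq_0\<close>.\<close>
      moreover obtain k where "c - l33 = real k" using N(4) by (auto elim: Nats_cases)
      ultimately have "racah_R n X \<alpha> \<beta> g \<delta> = 0"
        using Na le 2 delta weight_sum N
        by (intro racah_R_eq_0[where c = k]) (auto simp: par simp del: gt_patterns.simps)
      then show ?thesis using 2 by simp
    next
      case 3
      then have P: "(a + 1, x, z + 1) \<in> P"
        using Nats_minus_1[OF N'(3), of "l32 - (z + 1)"] Nats_add_1[OF N'(4), of "z + 1 - l33"] N'
          Nats_minus_1[OF N'(5), of "x - (a + 1)"]
        by simp
      have "S (a + 1, b, c) (a + 1, x, z + 1) = t_coeff wt x (a + 1) (z + 1) * (- s * racah_R n X \<alpha> \<beta> g \<delta>)"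
        using delta minus_one_powi_floor_add_1[of "z + 1 - b" "z - b"]
        by (simp add: s_def par algebra_simps del: t_coeff.simps)
      then show ?thesis using t_coeff_raise_22[OF M P] P
        by (simp add: t_def del: t_coeff.simps gt_patterns.simps gt_rotation_entry.simps flip: mult.assoc)
    qed
  qed
  have e: "2 * X + g + \<delta> = - (x - z + 1)" "X + g + \<delta> = - (l31 - z + 1)" "X + \<delta> = - (a + 1 - z)"
    using delta by (simp_all add: par)
  have q: "g * (2 * X + g + \<delta>) = (l31 - a) * (x - z + 1)"
    "(X + g) * (X + g + \<delta>) = (x - a) * (l31 - z + 1)"
    "X * (X + \<delta>) = - ((l31 - x) * (a + 1 - z))"
    unfolding e by (simp_all add: par algebra_simps)
  have "(l31 - a) * (x - z + 1) * racah_R n X \<alpha> \<beta> (g - 1) \<delta> =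
     (x - a) * (l31 - z + 1) * racah_R n X \<alpha> \<beta> g \<delta>
     + (l31 - x) * (a + 1 - z) * racah_R n (X - 1) \<alpha> \<beta> g \<delta>"
    using racah_R_lower[OF Na(1,2,5) le, unfolded q] by simp
  then have "racah_R n X \<alpha> \<beta> (g - 1) \<delta> =
     (x - a) * (l31 - z + 1) / ((x - z + 1) * (l31 - a)) * racah_R n X \<alpha> \<beta> g \<delta>
     + (l31 - x) * (a + 1 - z) / ((x - z + 1) * (l31 - a)) * racah_R n (X - 1) \<alpha> \<beta> g \<delta>"
    using nz by (simp only: times_divide_eq_left add_divide_distrib[symmetric] eq_divide_eq)
      (simp add: mult_ac)
  then show ?thesis unfolding S0 S1 S2 by (simp add: algebra_simps)
qed

text \<open>Matrix element of \<open>\<tau> e\<^sub>3\<^sub>1 = - e\<^sub>2\<^sub>1 \<tau>\<close>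
  from \<open>(a + 1, a + 1, c)\<close> to \<open>(a, x, z)\<close>. It serves the patterns with
  equal first two entries, which \<open>e21\<close> does not reach, and reduces to
  \<open>racah_R_raise\<close>.\<close>

lemma entry_raise:
  assumes L: "(a + 1, a + 1, c) \<in> P" and L': "(a, a, c) \<in> P" and M: "(a, x, z) \<in> P"
  shows "(a + 1 - l32) * (a + 2 - l33) / (a + 2 - c) * S (a, a, c) (a, x, z)
    - (l32 - c + 1) * (c - l33) / (a + 2 - c) *
       (if (a, a + 1, c - 1) \<in> P then S (a, a + 1, c - 1) (a, x, z) else 0) =
    - (if (a + 1, x, z) \<in> P then S (a + 1, a + 1, c) (a + 1, x, z) else 0)"
proof (cases "a + c = a - x - z")
  case False
  then show ?thesis by simp
next
  case delta: True
  note N = gt_pattern_Nats[OF L] and N1 = gt_pattern_Nats[OF L'] and N' = gt_pattern_Nats[OF M]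
  define t s where "t = t_coeff wt x a z" and "s = (-1 :: real) powi \<lfloor>z - (a + 1)\<rfloor>"
  \<comment> \<open>These are the parameters of \<open>(a + 1, a + 1, c)\<close>. For
    \<open>(a, a, c)\<close> and \<open>(a, a + 1, c - 1)\<close> the degrees are n + 1 and n, and
    \<beta>, \<gamma>, \<delta> change by -1, -1, 1.\<close>
  define n X \<alpha> \<beta> g \<delta> where par: "n = l31 - (a + 1)" "X = l31 - x" "\<alpha> = l32 - l31 - 1"
    "\<beta> = a + c + l33" "g = a - l31" "\<delta> = - (a + 1 + c) - l31 - 1"
  have nz: "a + 2 - c \<noteq> 0" "l31 - a \<noteq> 0" using N N' by (auto simp del: gt_patterns.simps)
  have Na: "n \<in> \<nat>" "X \<in> \<nat>" "- \<alpha> \<in> \<nat>" "- \<beta> - \<delta> \<in> \<nat>" "- g \<in> \<nat>"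
  proof -
    show "n \<in> \<nat>" "X \<in> \<nat>" "- g \<in> \<nat>" using N N' by (simp_all add: par del: gt_patterns.simps)
    show "- \<alpha> \<in> \<nat>" by (rule Nats_add_1[OF weight_Nats(1)]) (simp add: par)
    have "l31 - l33 + 1 \<in> \<nat>" by (rule Nats_add_1[OF weight_Nats(3)]) simp
    from Nats_add_1[OF this, of "- \<beta> - \<delta>"] show "- \<beta> - \<delta> \<in> \<nat>" by (simp add: par)
  qed
  have le: "n + 1 \<le> - \<alpha> - 1" "n + 1 \<le> - \<beta> - \<delta> - 1" "n + 1 \<le> - g"
     "X \<le> - \<alpha> - 1" "X \<le> - \<beta> - \<delta> - 1" "X \<le> - g"
    using N N1 N' by (auto simp: par simp del: gt_patterns.simps)
  define R1 R2 R3 where R: "R1 = racah_R (n + 1) X \<alpha> (\<beta> - 1) (g - 1) (\<delta> + 1)"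
    "R2 = racah_R n X \<alpha> (\<beta> - 1) (g - 1) (\<delta> + 1)" "R3 = racah_R n X \<alpha> \<beta> g \<delta>"
  have S1: "S (a, a, c) (a, x, z) = - (t * s * R1)"
  proof -
    have "l31 - a = n + 1" "a + c + l33 - 1 = \<beta> - 1" "a - l31 - 1 = g - 1" "- a - c - l31 - 1 = \<delta> + 1"
      "l32 - l31 - 1 = \<alpha>" "l31 - x = X"
      by (simp_all add: par)
    then show ?thesis
      using delta minus_one_powi_floor_add_1[of "z - a" "z - (a + 1)"]
      by (simp only: gt_rotation_entry.simps t_def s_def R) simp
  qed
  \<comment> \<open>The factor c - l33 is kept on both sides because at c = l33 the pattern
    \<open>(a, a + 1, c - 1)\<close> is missing.\<close>
  have S2: "(c - l33) * (if (a, a + 1, c - 1) \<in> P then S (a, a + 1, c - 1) (a, x, z) else 0) =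
     (c - l33) * (t * s * R2)"
  proof (cases "c = l33")
    case False
    then have P: "(a, a + 1, c - 1) \<in> P"
      using Nats_minus_1[OF N(4), of "c - 1 - l33"] Nats_add_1[OF N(3), of "l32 - (c - 1)"] N N1
        Nats_add_1[OF N1(6), of "a - (c - 1)"] by simp
    have "l31 - (a + 1) = n" "a + 1 + (c - 1) + l33 - 1 = \<beta> - 1" "a - l31 - 1 = g - 1"
      "- (a + 1) - (c - 1) - l31 - 1 = \<delta> + 1" "l32 - l31 - 1 = \<alpha>" "l31 - x = X"
      by (simp_all add: par)
    then have "S (a, a + 1, c - 1) (a, x, z) = t * s * R2"
      using delta by (simp only: gt_rotation_entry.simps t_def s_def R) simp
    then show ?thesis using P by simp
  qed simp
  have S3: "(l31 - a) * (if (a + 1, x, z) \<in> P then S (a + 1, a + 1, c) (a + 1, x, z) else 0) =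
     (a + 1 - z) * (x - a) * t * s * R3"
  proof (cases "x = a")
    case True
    then have "(a + 1, x, z) \<notin> P" using gt_pattern_Nats(11) by fastforce
    then show ?thesis using True by (simp del: gt_patterns.simps)
  next
    case False
    then have P: "(a + 1, x, z) \<in> P"
      using Nats_minus_1[OF N'(5), of "x - (a + 1)"] Nats_add_1[OF N'(6), of "a + 1 - z"] N'
      by simp
    have "S (a + 1, a + 1, c) (a + 1, x, z) = t_coeff wt x (a + 1) z * (s * R3)"
      using delta by (simp add: s_def par R algebra_simps del: t_coeff.simps)
    then show ?thesis using t_coeff_raise_11[OF M P] P
      by (simp add: t_def del: t_coeff.simps gt_patterns.simps gt_rotation_entry.simps flip: mult.assoc)
  qed
  have e: "n + \<alpha> + 1 = - (a + 1 - l32)" "n + \<beta> + \<delta> + 1 = - (a + 2 - l33)"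
    "n + \<beta> = - (l32 - c + 1)" "n + \<alpha> - \<delta> = c - l33" "2 * n + \<alpha> + \<beta> + 1 = - (a + 2 - c)"
    "X + g = - (x - a)" "X + \<delta> + 1 = - (a + 1 - z)" "g = - (l31 - a)"
    using delta weight_sum by (simp_all add: par)
  have q: "(n + \<alpha> + 1) * (n + \<beta> + \<delta> + 1) = (a + 1 - l32) * (a + 2 - l33)"
    "(n + \<beta>) * (n + \<alpha> - \<delta>) = - ((l32 - c + 1) * (c - l33))"
    "(X + g) * (X + \<delta> + 1) = (x - a) * (a + 1 - z)"
    by (metis e(1,2) minus_mult_minus, metis e(3,4) mult_minus_left, metis e(6,7) minus_mult_minus)
  have g: "l31 - a = - g" by (simp add: par)
  have "g * ((a + 1 - l32) * (a + 2 - l33) * R1 + (l32 - c + 1) * (c - l33) * R2) =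
      - ((a + 2 - c) * ((x - a) * (a + 1 - z) * R3))"
    using racah_R_raise[OF Na le, folded R, unfolded q e(5)]
    by (simp only: mult_minus_left diff_minus_eq_add)
  then have "(l31 - a) * ((a + 1 - l32) * (a + 2 - l33) * R1 + (l32 - c + 1) * (c - l33) * R2) =
      (a + 2 - c) * ((x - a) * (a + 1 - z) * R3)"
    by (simp only: g mult_minus_left minus_minus)
  then have *: "(a + 1 - l32) * (a + 2 - l33) * R1 + (l32 - c + 1) * (c - l33) * R2 =
      (a + 2 - c) * ((x - a) * (a + 1 - z) * R3) / (l31 - a)"
    using nz by (simp add: eq_divide_eq mult.commute)
  have "(a + 1 - l32) * (a + 2 - l33) / (a + 2 - c) * S (a, a, c) (a, x, z)
    - (l32 - c + 1) * (c - l33) / (a + 2 - c) *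
       (if (a, a + 1, c - 1) \<in> P then S (a, a + 1, c - 1) (a, x, z) else 0) =
    - (((a + 1 - l32) * (a + 2 - l33) * R1 * t * s + (l32 - c + 1) * ((c - l33) * (t * s * R2))) / (a + 2 - c))"
    unfolding S1 S2[symmetric] by (simp add: add_divide_distrib diff_divide_distrib algebra_simps)
  also have "\<dots> = - (((a + 1 - l32) * (a + 2 - l33) * R1 + (l32 - c + 1) * (c - l33) * R2) * (t * s) / (a + 2 - c))"
    by (simp add: algebra_simps)
  also have "\<dots> = - (((a + 1 - z) * (x - a) * t * s * R3) / (l31 - a))"
    unfolding * using nz by simp
  finally show ?thesis unfolding S3[symmetric] using nz by simp
qed

text \<open>For first entry l31 both the degree and the argument of the Racah polynomial are 0, so
  its value is 1 and only t and the sign remain.\<close>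

lemma entry_top:
  assumes "(l31, l31, c) \<in> P" "(l31, x, z) \<in> P"
  shows "S (l31, l31, c) (l31, x, z) =
    (if x = l31 \<and> z = l32 + l33 - c
     then (-1) powi \<lfloor>l32 + l33 - c - l31\<rfloor> * (rfact (c - l33) / rfact (l32 - c)) else 0)"
proof -
  note N = gt_pattern_Nats[OF assms(1)] and N' = gt_pattern_Nats[OF assms(2)]
  have x: "x = l31" using N' by linarith
  have d: "l31 + c = l31 - x - z \<longleftrightarrow> z = l32 + l33 - c"
    using x weight_sum by auto
  have R: "racah_R 0 0 (l32 - l31 - 1) (l31 + c + l33 - 1) (- 1) (- l31 - c - l31 - 1) = 1"
    using Nats_ge_0[OF weight_Nats(1)] Nats_ge_0[OF weight_Nats(3)]
    by (simp add: racah_R_def)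
  have "rfact (l31 - z + 1) = (l31 - z + 1) * rfact (l31 - z)"
    by (rule rfact_add_1[OF N'(16)]) simp
  moreover have "l31 - z + 1 \<noteq> 0" using N' by linarith
  ultimately have t: "t_coeff wt l31 l31 z = rfact (l32 - z) / rfact (z - l33)"
    by (simp add: divide_simps)
  have "S (l31, l31, c) (l31, x, z) =
    (if z = l32 + l33 - c then rfact (l32 - z) / rfact (z - l33) * (-1) powi \<lfloor>z - l31\<rfloor> else 0)"
    unfolding x gt_rotation_entry.simps d[unfolded x] t using R by simp
  moreover have "l32 - z = c - l33" "z - l33 = l32 - c" "z - l31 = l32 + l33 - c - l31" if "z = l32 + l33 - c"
    using that by simp_all
  ultimately show ?thesis using x by (simp del: gt_rotation_entry.simps)
qed

end

section \<open>The action of the Lie algebra\<close>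

text \<open>Taking a triple makes this a linear map on a product space, so that curves of diagonal
  matrices can be differentiated componentwise.\<close>

definition diag3 :: "complex \<times> complex \<times> complex \<Rightarrow> complex^3^3" where
  "diag3 = (\<lambda>(u, v, w). vector [vector [u, 0, 0], vector [0, v, 0], vector [0, 0, w]])"

definition T_rot_inv :: "complex^3^3" where
  "T_rot_inv = vector [vector [1, 0, 0], vector [0, 0, -1], vector [0, 1, 0]]"

definition E21 :: "complex^3^3" where
  "E21 = vector [vector [0, 0, 0], vector [1, 0, 0], vector [0, 0, 0]]"

definition E31 :: "complex^3^3" where
  "E31 = vector [vector [0, 0, 0], vector [0, 0, 0], vector [1, 0, 0]]"

definition E23 :: "complex^3^3" where
  "E23 = vector [vector [0, 0, 0], vector [0, 0, 1], vector [0, 0, 0]]"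

definition E32 :: "complex^3^3" where
  "E32 = vector [vector [0, 0, 0], vector [0, 0, 0], vector [0, 1, 0]]"

lemmas mat3_simps = vec_eq_iff forall_3 matrix_matrix_mult_def sum_3 mat_def vector_3
  diag3_def T_rot_def T_rot_inv_def E21_def E31_def E23_def E32_def

lemma T_rot_inverse: "T_rot ** T_rot_inv = mat 1" "T_rot_inv ** T_rot = mat 1"
  by (simp_all add: mat3_simps)

lemma matrix_inv_T_rot: "matrix_inv T_rot = T_rot_inv"
proof -
  have "invertible T_rot" using T_rot_inverse by (auto simp: invertible_def)
  then have "matrix_inv T_rot ** T_rot = mat 1"
    unfolding invertible_def matrix_inv_def by (rule someI2_ex) simp
  then have "matrix_inv T_rot ** (T_rot ** T_rot_inv) = T_rot_inv"
    by (simp add: matrix_mul_assoc)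
  then show ?thesis by (simp add: T_rot_inverse)
qed

lemma T_rot_conj:
  "T_rot_inv ** E21 ** T_rot = E31"
  "T_rot_inv ** E31 ** T_rot = - E21"
  "T_rot_inv ** E32 ** T_rot = - E23"
  "T_rot_inv ** diag3 (u, v, w) ** T_rot = diag3 (u, w, v)"
  by (simp_all add: mat3_simps)

lemma SL3_members: "T_rot \<in> SL3" "T_rot_inv \<in> SL3" "u * v * w = 1 \<Longrightarrow> diag3 (u, v, w) \<in> SL3"
  by (simp_all add: SL3_def det_3 mat3_simps)

lemma SL3_mult: "A \<in> SL3 \<Longrightarrow> B \<in> SL3 \<Longrightarrow> A ** B \<in> SL3"
  by (simp add: SL3_def det_mul)

lemma sl3_members: "E21 \<in> sl3" "E31 \<in> sl3" "E32 \<in> sl3" "u + v + w = 0 \<Longrightarrow> diag3 (u, v, w) \<in> sl3"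
  by (simp_all add: sl3_def trace_def mat3_simps)

lemma bounded_linear_matrix_conj: "bounded_linear (\<lambda>Y :: complex^3^3. A ** Y ** B)"
proof -
  have "linear (\<lambda>Y :: complex^3^3. A ** Y ** B)"
    by (rule linearI) (simp_all add: vec_eq_iff matrix_matrix_mult_def scaleR_sum_right
        sum.distrib distrib_left distrib_right sum_distrib_right)
  then show ?thesis by (simp add: linear_conv_bounded_linear)
qed

lemma bounded_linear_diag3: "bounded_linear diag3"
proof -
  have "linear diag3"
    by (rule linearI) (auto simp: mat3_simps)
  then show ?thesis by (simp add: linear_conv_bounded_linear)
qed

definition diag_curve :: "complex \<Rightarrow> complex \<Rightarrow> complex \<Rightarrow> real \<Rightarrow> complex^3^3" where
  "diag_curve u v w s = diag3 (exp (of_real s * u), exp (of_real s * v), exp (of_real s * w))"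

lemma diag_curve:
  assumes "u + v + w = 0"
  shows "diag_curve u v w s \<in> SL3" "diag_curve u v w 0 = mat 1"
    "(diag_curve u v w has_vector_derivative diag3 (u, v, w)) (at 0)"
    "diag_curve u v w (s + t) = diag_curve u v w s ** diag_curve u v w t"
proof -
  have "exp (of_real s * u) * exp (of_real s * v) * exp (of_real s * w) = exp (of_real s * (u + v + w))"
    by (simp add: exp_add distrib_left)
  then show "diag_curve u v w s \<in> SL3"
    using assms by (simp add: diag_curve_def SL3_members)
  show "diag_curve u v w 0 = mat 1" by (simp add: diag_curve_def mat3_simps)
  have e: "((\<lambda>s. exp (of_real s * y)) has_vector_derivative y) (at 0)" for y :: complex
  proof -
    have "((\<lambda>s. exp (s * y)) has_field_derivative y) (at (of_real 0))"
      by (auto intro!: derivative_eq_intros)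
    then show ?thesis by (rule has_vector_derivative_real_field)
  qed
  show "(diag_curve u v w has_vector_derivative diag3 (u, v, w)) (at 0)"
    unfolding diag_curve_def
    by (rule bounded_linear.has_vector_derivative[OF bounded_linear_diag3])
      (intro has_vector_derivative_Pair e)
  show "diag_curve u v w (s + t) = diag_curve u v w s ** diag_curve u v w t"
    by (simp add: diag_curve_def mat3_simps distrib_right exp_add)
qed

text \<open>Each of these X has square zero, so 1 + sX is its exponential and has determinant
  1.\<close>

lemma unipotent_curve:
  assumes "X \<in> {E21, E31, E32}"
  shows "mat 1 + s *\<^sub>R X \<in> SL3" "((\<lambda>s. mat 1 + s *\<^sub>R X) has_vector_derivative X) (at 0)"
proof -
  show "mat 1 + s *\<^sub>R X \<in> SL3"
    using assms by (auto simp: SL3_def det_3 mat3_simps)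
  show "((\<lambda>s. mat 1 + s *\<^sub>R X) has_vector_derivative X) (at 0)"
    by (auto intro!: derivative_eq_intros)
qed

section \<open>Coordinates of the action\<close>

lemma gt_xi_in_space: "gt_xi l L \<in> gt_space l"
  by (auto simp: gt_space_def gt_xi_def)

lemma gt_xi_outside: "M \<notin> gt_patterns l \<Longrightarrow> gt_xi l L M = 0"
  by (auto simp: gt_xi_def)

context gt_weight
begin

abbreviation V :: "gtvec set" where "V \<equiv> gt_space wt"
abbreviation \<xi> :: "pattern \<Rightarrow> gtvec" where "\<xi> \<equiv> gt_xi wt"

lemma V_outside: "v \<in> V \<Longrightarrow> M \<notin> P \<Longrightarrow> v M = 0"
  unfolding gt_space_def by blast

lemma V_eqI:
  assumes "u \<in> V" "v \<in> V" "\<And>a x z. (a, x, z) \<in> P \<Longrightarrow> u (a, x, z) = v (a, x, z)"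
  shows "u = v"
proof
  fix M :: pattern
  obtain a x z where M: "M = (a, x, z)" by (cases M)
  show "u M = v M"
  proof (cases "M \<in> P")
    case True
    then show ?thesis unfolding M by (rule assms(3))
  next
    case False
    then show ?thesis using assms(1,2)[THEN V_outside] by metis
  qed
qed

lemma V_scale: "v \<in> V \<Longrightarrow> (\<lambda>M. c * v M) \<in> V"
  by (simp add: gt_space_def)

lemma V_expand: "v \<in> V \<Longrightarrow> v = (\<lambda>M. \<Sum>L\<in>P. v L * \<xi> L M)"
  by (rule ext) (auto simp: gt_xi_def if_distrib finite_gt_patterns V_outside cong: if_cong
    simp del: gt_patterns.simps)

text \<open>Exactly one triple is sent to \<open>M\<close> by \<open>F\<close>, so at most one basis
  vector contributes. If this triple is not a pattern, the coordinate of \<open>v\<close> there is 0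
  and the formula still holds.\<close>

lemma sum_shift:
  assumes M: "M \<in> P" and v: "v \<in> V"
    and F: "\<And>p q r. F p q r = M \<longleftrightarrow> (p, q, r) = (p0, q0, r0)"
  shows "(\<Sum>L\<in>P. v L * (case L of (p, q, r) \<Rightarrow> G p q r * \<xi> (F p q r) M)) = G p0 q0 r0 * v (p0, q0, r0)"
proof -
  have "(\<Sum>L\<in>P. v L * (case L of (p, q, r) \<Rightarrow> G p q r * \<xi> (F p q r) M)) =
      (\<Sum>L\<in>P. if L = (p0, q0, r0) then G p0 q0 r0 * v (p0, q0, r0) else 0)"
  proof (rule sum.cong[OF refl])
    fix L :: pattern
    obtain p q r where L: "L = (p, q, r)" by (cases L)
    have "\<xi> (F p q r) M = (if F p q r = M then 1 else 0)"
      unfolding gt_xi_def using M by metis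
    also have "\<dots> = (if L = (p0, q0, r0) then 1 else 0)"
      unfolding F L ..
    finally show "v L * (case L of (p, q, r) \<Rightarrow> G p q r * \<xi> (F p q r) M) =
      (if L = (p0, q0, r0) then G p0 q0 r0 * v (p0, q0, r0) else 0)"
      by (simp add: L)
  qed
  also have "\<dots> = G p0 q0 r0 * v (p0, q0, r0)"
    using V_outside[OF v, of "(p0, q0, r0)"]
    by (simp add: finite_gt_patterns del: gt_patterns.simps)
  finally show ?thesis .
qed

lemma lin_ext_in_V: "(\<And>L M. M \<notin> P \<Longrightarrow> f L M = 0) \<Longrightarrow> lin_ext wt f v \<in> V"
  by (simp add: lin_ext_def gt_space_def del: gt_patterns.simps)

lemma e_in_V:
  "e11 wt v \<in> V" "e22 wt v \<in> V" "e33 wt v \<in> V" "e12 wt v \<in> V" "e21 wt v \<in> V" "e23 wt v \<in> V"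
  "e32 wt v \<in> V"
  unfolding e11_def e22_def e33_def e12_def e21_def e23.simps e32.simps
  by (rule lin_ext_in_V; simp add: gt_xi_outside split: prod.splits del: gt_patterns.simps)+

lemma e13_e31_in_V: "e13 wt v \<in> V" "e31 wt v \<in> V"
  using e_in_V by (simp_all add: e13_def e31_def gt_space_def del: gt_patterns.simps)

lemma gt_action_in_V: "gt_action wt X v \<in> V"
  using e_in_V e13_e31_in_V by (simp add: gt_action_def gt_space_def del: gt_patterns.simps)

lemma e_diag_apply:
  assumes M: "(a, x, z) \<in> P" and v: "v \<in> V"
  shows "e11 wt v (a, x, z) = of_real a * v (a, x, z)"
    "e22 wt v (a, x, z) = of_real (x + z - a) * v (a, x, z)"
    "e33 wt v (a, x, z) = of_real (- (x + z)) * v (a, x, z)"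
proof -
  note [simp del] = gt_patterns.simps
  have F: "(p, q, r) = (a, x, z) \<longleftrightarrow> (p, q, r) = (a, x, z)" for p q r :: real by simp
  note * = sum_shift[OF M v, where F="\<lambda>p q r. (p, q, r)", OF F]
  show "e11 wt v (a, x, z) = of_real a * v (a, x, z)"
    using *[of "\<lambda>p q r. of_real p"] by (simp add: e11_def lin_ext_def case_prod_beta)
  show "e22 wt v (a, x, z) = of_real (x + z - a) * v (a, x, z)"
    using *[of "\<lambda>p q r. of_real (q + r - p)"] by (simp add: e22_def lin_ext_def case_prod_beta)
  show "e33 wt v (a, x, z) = of_real (- (x + z)) * v (a, x, z)"
    using *[of "\<lambda>p q r. of_real (- (q + r))"] by (simp add: e33_def lin_ext_def case_prod_beta)
qed

lemma e21_apply:
  assumes M: "(a, x, z) \<in> P" and v: "v \<in> V"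
  shows "e21 wt v (a, x, z) = v (a + 1, x, z)"
proof -
  have "(p - 1, q, r) = (a, x, z) \<longleftrightarrow> (p, q, r) = (a + 1, x, z)" for p q r :: real by auto
  from sum_shift[OF M v, where F="\<lambda>p q r. (p - 1, q, r)", OF this, of "\<lambda>p q r. 1"]
  show ?thesis by (simp add: e21_def lin_ext_def case_prod_beta del: gt_patterns.simps)
qed

lemma e32_apply:
  assumes M: "(a, x, z) \<in> P" and v: "v \<in> V"
  shows "e32 wt v (a, x, z) =
    of_real ((x + 1 - l32) * (x + 2 - l33) * (x + 1 - a) / (x - z + 2)) * v (a, x + 1, z)
    + of_real ((a - z) * (l32 - z) * (z + 1 - l33) / (x - z)) * v (a, x, z + 1)"
proof -
  have 1: "(p, q - 1, r) = (a, x, z) \<longleftrightarrow> (p, q, r) = (a, x + 1, z)" for p q r :: real by auto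
  have 2: "(p, q, r - 1) = (a, x, z) \<longleftrightarrow> (p, q, r) = (a, x, z + 1)" for p q r :: real by auto
  let ?G1 = "\<lambda>p q r. complex_of_real ((q - l32) * (q - l33 + 1) * (q - p) / (q - r + 1))"
  let ?G2 = "\<lambda>p q r. complex_of_real ((p - r + 1) * (l32 - r + 1) * (r - l33) / (q - r + 1))"
  have "e32 wt v (a, x, z) = ?G1 a (x + 1) z * v (a, x + 1, z) + ?G2 a x (z + 1) * v (a, x, z + 1)"
    using sum_shift[OF M v, where F="\<lambda>p q r. (p, q - 1, r)", OF 1, of ?G1]
      sum_shift[OF M v, where F="\<lambda>p q r. (p, q, r - 1)", OF 2, of ?G2]
    by (simp only: e32.simps lin_ext_def case_prod_beta distrib_left sum.distrib)
  also have "?G1 a (x + 1) z = of_real ((x + 1 - l32) * (x + 2 - l33) * (x + 1 - a) / (x - z + 2))"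
    by (simp add: algebra_simps)
  also have "?G2 a x (z + 1) = of_real ((a - z) * (l32 - z) * (z + 1 - l33) / (x - z))"
    by simp
  finally show ?thesis .
qed

lemma e23_apply:
  assumes M: "(a, x, z) \<in> P" and v: "v \<in> V"
  shows "e23 wt v (a, x, z) =
    of_real ((l31 - x + 1) / (x - z)) * v (a, x - 1, z)
    + of_real ((l31 - z + 2) / (x - z + 2)) * v (a, x, z - 1)"
proof -
  have 1: "(p, q + 1, r) = (a, x, z) \<longleftrightarrow> (p, q, r) = (a, x - 1, z)" for p q r :: real by auto
  have 2: "(p, q, r + 1) = (a, x, z) \<longleftrightarrow> (p, q, r) = (a, x, z - 1)" for p q r :: real by auto
  let ?G1 = "\<lambda>p q r. complex_of_real ((l31 - q) / (q - r + 1))"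
  let ?G2 = "\<lambda>p q r. complex_of_real ((l31 - r + 1) / (q - r + 1))"
  have "e23 wt v (a, x, z) = ?G1 a (x - 1) z * v (a, x - 1, z) + ?G2 a x (z - 1) * v (a, x, z - 1)"
    using sum_shift[OF M v, where F="\<lambda>p q r. (p, q + 1, r)", OF 1, of ?G1]
      sum_shift[OF M v, where F="\<lambda>p q r. (p, q, r + 1)", OF 2, of ?G2]
    by (simp only: e23.simps lin_ext_def case_prod_beta distrib_left sum.distrib)
  also have "?G1 a (x - 1) z = of_real ((l31 - x + 1) / (x - z))"
    by (simp add: algebra_simps)
  also have "?G2 a x (z - 1) = of_real ((l31 - z + 2) / (x - z + 2))"
    by (simp add: algebra_simps)
  finally show ?thesis .
qed

text \<open>In the commutator the factors involving a differ by one: (x + 1 - a) - (x - a) = 1 and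
  (a - z) - (a + 1 - z) = -1. An intermediate pattern that is missing while the target coordinate
  survives comes with a zero factor.\<close>

lemma e31_apply:
  assumes M: "(a, x, z) \<in> P" and v: "v \<in> V"
  shows "e31 wt v (a, x, z) =
    of_real ((x + 1 - l32) * (x + 2 - l33) / (x - z + 2)) * v (a + 1, x + 1, z)
    - of_real ((l32 - z) * (z + 1 - l33) / (x - z)) * v (a + 1, x, z + 1)"
proof -
  note [simp del] = gt_patterns.simps
  define C D where CD: "C = (x + 1 - l32) * (x + 2 - l33) / (x - z + 2)"
    "D = (l32 - z) * (z + 1 - l33) / (x - z)"
  have A: "e32 wt u (a, x, z) =
      of_real (C * (x + 1 - a)) * u (a, x + 1, z) + of_real (D * (a - z)) * u (a, x, z + 1)" if "u \<in> V" for u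
  proof -
    have "(x + 1 - l32) * (x + 2 - l33) * (x + 1 - a) / (x - z + 2) = C * (x + 1 - a)"
      "(a - z) * (l32 - z) * (z + 1 - l33) / (x - z) = D * (a - z)"
      by (simp_all add: CD mult_ac)
    then show ?thesis using e32_apply[OF M that] by (simp only:)
  qed
  have B: "e32 wt v (a + 1, x, z) =
      of_real (C * (x - a)) * v (a + 1, x + 1, z) + of_real (D * (a + 1 - z)) * v (a + 1, x, z + 1)"
    if "(a + 1, x, z) \<in> P"
  proof -
    have "(x + 1 - l32) * (x + 2 - l33) * (x + 1 - (a + 1)) / (x - z + 2) = C * (x - a)"
      "(a + 1 - z) * (l32 - z) * (z + 1 - l33) / (x - z) = D * (a + 1 - z)"
      by (simp_all add: CD mult_ac)
    then show ?thesis using e32_apply[OF that v] by (simp only:)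
  qed
  have e21: "e21 wt v (p, q, r) = (if (p, q, r) \<in> P then v (p + 1, q, r) else 0)" for p q r
    using e21_apply[OF _ v] V_outside[OF e_in_V(5)] by auto
  have e32: "e21 wt (e32 wt v) (a, x, z) = (if (a + 1, x, z) \<in> P then e32 wt v (a + 1, x, z) else 0)"
    using e21_apply[OF M e_in_V(7)] V_outside[OF e_in_V(7)] by auto
  \<comment> \<open>If \<open>(a + 1, x + 1, z)\<close> is a pattern, then so is
    \<open>(a, x + 1, z)\<close>, while \<open>(a + 1, x, z)\<close> can be missing only for x = a,
    where the factor x - a is zero.\<close>
  have 1: "of_real (C * (x + 1 - a)) * e21 wt v (a, x + 1, z)
      - (if (a + 1, x, z) \<in> P then of_real (C * (x - a)) * v (a + 1, x + 1, z) else 0) =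
      of_real C * v (a + 1, x + 1, z)"
  proof (cases "(a + 1, x + 1, z) \<in> P")
    case True
    have "(a, x + 1, z) \<in> P"
      using gt_pattern_Nats[OF True] gt_pattern_Nats[OF M] Nats_add_1[OF gt_pattern_Nats(5)[OF True], of "x + 1 - a"]
      by (simp add: gt_patterns.simps)
    moreover have "x = a" if "(a + 1, x, z) \<notin> P"
    proof (rule ccontr)
      assume "x \<noteq> a"
      then show False
        using that gt_pattern_Nats[OF True] gt_pattern_Nats[OF M] Nats_minus_1[OF gt_pattern_Nats(5)[OF M], of "x - (a + 1)"]
        by (simp add: gt_patterns.simps)
    qed
    ultimately show ?thesis
      by (cases "(a + 1, x, z) \<in> P") (auto simp: e21 algebra_simps)
  next
    case False
    then show ?thesis by (simp add: e21 V_outside[OF v])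
  qed
  \<comment> \<open>Here \<open>(a, x, z + 1)\<close> can be missing, but only for z = a, where the
    factor a - z is zero.\<close>
  have 2: "of_real (D * (a - z)) * e21 wt v (a, x, z + 1)
      - (if (a + 1, x, z) \<in> P then of_real (D * (a + 1 - z)) * v (a + 1, x, z + 1) else 0) =
      - of_real D * v (a + 1, x, z + 1)"
  proof (cases "(a + 1, x, z + 1) \<in> P")
    case True
    have "(a + 1, x, z) \<in> P"
      using gt_pattern_Nats[OF True] gt_pattern_Nats[OF M] Nats_add_1[OF gt_pattern_Nats(6)[OF M], of "a + 1 - z"]
      by (simp add: gt_patterns.simps)
    moreover have "z = a" if "(a, x, z + 1) \<notin> P"
    proof (rule ccontr)
      assume "z \<noteq> a"
      then show False
        using that gt_pattern_Nats[OF True] gt_pattern_Nats[OF M] Nats_minus_1[OF gt_pattern_Nats(6)[OF M], of "a - (z + 1)"]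
        by (simp add: gt_patterns.simps)
    qed
    ultimately show ?thesis
      by (cases "(a, x, z + 1) \<in> P") (auto simp: e21 algebra_simps)
  next
    case False
    then show ?thesis by (simp add: e21 V_outside[OF v])
  qed
  have "e31 wt v (a, x, z) =
     (of_real (C * (x + 1 - a)) * e21 wt v (a, x + 1, z)
      - (if (a + 1, x, z) \<in> P then of_real (C * (x - a)) * v (a + 1, x + 1, z) else 0))
     + (of_real (D * (a - z)) * e21 wt v (a, x, z + 1)
      - (if (a + 1, x, z) \<in> P then of_real (D * (a + 1 - z)) * v (a + 1, x, z + 1) else 0))"
    unfolding e31_def e32 A[OF e_in_V(5)] by (simp add: B del: e32.simps)
  also have "\<dots> = of_real C * v (a + 1, x + 1, z) - of_real D * v (a + 1, x, z + 1)"
    unfolding 1 2 by simp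
  finally show ?thesis unfolding CD .
qed

lemma gt_action_elementary:
  "gt_action wt E21 v = e21 wt v" "gt_action wt E31 v = e31 wt v" "gt_action wt E32 v = e32 wt v"
  "gt_action wt (- E21) v = (\<lambda>M. - e21 wt v M)" "gt_action wt (- E23) v = (\<lambda>M. - e23 wt v M)"
  by (simp_all add: gt_action_def E21_def E31_def E32_def E23_def fun_eq_iff)

lemma gt_action_diag3:
  assumes M: "(a, x, z) \<in> P" and v: "v \<in> V"
  shows "gt_action wt (diag3 (u1, u2, u3)) v (a, x, z) =
    (u1 * of_real a + u2 * of_real (x + z - a) - u3 * of_real (x + z)) * v (a, x, z)"
  by (simp add: gt_action_def diag3_def e_diag_apply[OF M v] algebra_simps)

end

section \<open>The operator representing the rotation\<close>

locale gt_integrated = gt_weight +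
  fixes \<pi> :: "complex^3^3 \<Rightarrow> gtvec \<Rightarrow> gtvec"
  assumes rep: "integrates_gt_action (l31, l32, l33) \<pi>"
begin

declare gt_patterns.simps [simp del] e32.simps [simp del] e23.simps [simp del]
  gt_rotation_entry.simps [simp del]

section \<open>Differentiation in the representation and intertwining\<close>

lemma pi_closed: "A \<in> SL3 \<Longrightarrow> v \<in> V \<Longrightarrow> \<pi> A v \<in> V"
  and pi_lin: "A \<in> SL3 \<Longrightarrow> u \<in> V \<Longrightarrow> v \<in> V \<Longrightarrow>
    \<pi> A (\<lambda>M. c * u M + d * v M) = (\<lambda>M. c * \<pi> A u M + d * \<pi> A v M)"
  and pi_one: "v \<in> V \<Longrightarrow> \<pi> (mat 1) v = v"
  and pi_mult: "A \<in> SL3 \<Longrightarrow> B \<in> SL3 \<Longrightarrow> v \<in> V \<Longrightarrow> \<pi> (A ** B) v = \<pi> A (\<pi> B v)"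
  using rep unfolding integrates_gt_action_def SL3_representation_def by blast+

lemma pi_deriv:
  assumes "\<And>s. \<gamma> s \<in> SL3" "\<gamma> 0 = mat 1" "(\<gamma> has_vector_derivative X) (at 0)" "X \<in> sl3" "v \<in> V"
  shows "((\<lambda>s. \<pi> (\<gamma> s) v M) has_vector_derivative gt_action wt X v M) (at 0)"
proof (cases "M \<in> P")
  case True
  then show ?thesis using rep assms unfolding integrates_gt_action_def by blast
next
  case False
  have "(\<lambda>s. \<pi> (\<gamma> s) v M) = (\<lambda>s. 0)" "gt_action wt X v M = 0"
    using V_outside[OF pi_closed False] V_outside[OF gt_action_in_V False] assms by auto
  then show ?thesis by simp
qed

lemma pi_scale: "A \<in> SL3 \<Longrightarrow> u \<in> V \<Longrightarrow> \<pi> A (\<lambda>M. c * u M) = (\<lambda>M. c * \<pi> A u M)"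
  using pi_lin[of A u u c 0] by simp

lemma pi_expand:
  assumes A: "A \<in> SL3" and v: "v \<in> V"
  shows "\<pi> A v = (\<lambda>M. \<Sum>L\<in>P. v L * \<pi> A (\<xi> L) M)"
proof -
  have *: "(\<lambda>M. \<Sum>L\<in>F. v L * \<xi> L M) \<in> V \<and>
      \<pi> A (\<lambda>M. \<Sum>L\<in>F. v L * \<xi> L M) = (\<lambda>M. \<Sum>L\<in>F. v L * \<pi> A (\<xi> L) M)"
    if "finite F" for F
    using that
  proof (induction F)
    case empty
    have "(\<lambda>M. 0) \<in> V" by (simp add: gt_space_def)
    then show ?case using pi_scale[OF A, of "\<lambda>M. 0" 0] by simp
  next
    case (insert L F)
    then have "(\<lambda>M. \<Sum>L\<in>F. v L * \<xi> L M) \<in> V" by blast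
    from pi_lin[OF A gt_xi_in_space this, of "v L" L 1] insert
    show ?case using gt_xi_in_space[of wt L] by (auto simp: gt_space_def)
  qed
  show ?thesis
    using *[OF finite_gt_patterns, of wt] V_expand[OF v] by simp
qed

text \<open>By \<open>pi_expand\<close> each coordinate is a finite linear combination of
  coordinates of \<open>w s\<close> with constant coefficients, so the operator commutes with the
  derivative.\<close>

lemma pi_has_vector_derivative:
  assumes A: "A \<in> SL3" and w: "\<And>s. w s \<in> V" "w' \<in> V"
    and d: "\<And>L. ((\<lambda>s. w s L) has_vector_derivative w' L) (at s0)"
  shows "((\<lambda>s. \<pi> A (w s) M) has_vector_derivative \<pi> A w' M) (at s0)"
  unfolding pi_expand[OF A w(1)] pi_expand[OF A w(2)]
  by (intro has_vector_derivative_sum has_vector_derivative_mult_left d)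

text \<open>Differentiate \<open>\<pi> (A (\<gamma> s) B) \<circ> \<pi> A = \<pi> A \<circ> \<pi> (\<gamma> s)\<close> at \<open>s = 0\<close>.\<close>

lemma intertwine:
  assumes A: "A \<in> SL3" "B \<in> SL3" "A ** B = mat 1" "B ** A = mat 1"
    and c: "\<And>s. \<gamma> s \<in> SL3" "\<gamma> 0 = mat 1" "(\<gamma> has_vector_derivative X) (at 0)"
    and X: "X \<in> sl3" and v: "v \<in> V"
  shows "\<pi> A (gt_action wt X v) = gt_action wt (A ** X ** B) (\<pi> A v)"
proof
  fix M
  have "trace (A ** X ** B) = 0"
    using X A(4) trace_mul_sym[of "A ** X" B] by (simp add: sl3_def matrix_mul_assoc)
  then have sl3: "A ** X ** B \<in> sl3" by (simp add: sl3_def)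
  have "((\<lambda>s. \<pi> (A ** \<gamma> s ** B) (\<pi> A v) M) has_vector_derivative gt_action wt (A ** X ** B) (\<pi> A v) M) (at 0)"
  proof (rule pi_deriv)
    show "((\<lambda>s. A ** \<gamma> s ** B) has_vector_derivative A ** X ** B) (at 0)"
      by (rule bounded_linear.has_vector_derivative[OF bounded_linear_matrix_conj c(3)])
  qed (use A c v sl3 in \<open>simp_all add: SL3_mult pi_closed\<close>)
  moreover have "\<pi> (A ** \<gamma> s ** B) (\<pi> A v) = \<pi> A (\<pi> (\<gamma> s) v)" for s
  proof -
    have "\<pi> (A ** \<gamma> s ** B) (\<pi> A v) = \<pi> (A ** \<gamma> s ** B ** A) v"
      using A c v by (simp add: SL3_mult pi_mult[symmetric])
    also have "A ** \<gamma> s ** B ** A = A ** \<gamma> s"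
      using A(4) by (simp add: matrix_mul_assoc[symmetric])
    finally show ?thesis using A c v by (simp add: pi_mult)
  qed
  moreover have "((\<lambda>s. \<pi> A (\<pi> (\<gamma> s) v) M) has_vector_derivative \<pi> A (gt_action wt X v) M) (at 0)"
    using A c X v by (intro pi_has_vector_derivative pi_closed gt_action_in_V pi_deriv)
  ultimately show "\<pi> A (gt_action wt X v) M = gt_action wt (A ** X ** B) (\<pi> A v) M"
    by (simp add: vector_derivative_unique_at)
qed

abbreviation \<tau> :: "gtvec \<Rightarrow> gtvec" where "\<tau> \<equiv> \<pi> T_rot_inv"

lemma tau_closed: "v \<in> V \<Longrightarrow> \<tau> v \<in> V"
  by (simp add: pi_closed SL3_members)

lemma tau_unipotent:
  assumes "X \<in> {E21, E31, E32}" "v \<in> V"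
  shows "\<tau> (gt_action wt X v) = gt_action wt (T_rot_inv ** X ** T_rot) (\<tau> v)"
  using assms unipotent_curve[OF assms(1)] sl3_members
  by (intro intertwine[where \<gamma> = "\<lambda>s. mat 1 + s *\<^sub>R X"]) (auto simp: SL3_members T_rot_inverse)

lemma tau_intertwine:
  assumes "v \<in> V"
  shows "\<tau> (e21 wt v) = e31 wt (\<tau> v)"
    "\<tau> (e31 wt v) = (\<lambda>M. - e21 wt (\<tau> v) M)"
    "\<tau> (e32 wt v) = (\<lambda>M. - e23 wt (\<tau> v) M)"
  using tau_unipotent[OF _ assms, of E21] tau_unipotent[OF _ assms, of E31] tau_unipotent[OF _ assms, of E32]
  by (simp_all add: gt_action_elementary T_rot_conj)

lemma tau_diag3:
  assumes "v \<in> V" "u1 + u2 + u3 = 0"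
  shows "\<tau> (gt_action wt (diag3 (u1, u2, u3)) v) = gt_action wt (diag3 (u1, u3, u2)) (\<tau> v)"
  using intertwine[of T_rot_inv T_rot "diag_curve u1 u2 u3" "diag3 (u1, u2, u3)" v] assms
    diag_curve[OF assms(2)] sl3_members(4)[OF assms(2)]
  by (simp add: SL3_members T_rot_inverse T_rot_conj)

lemma gt_action_diag3_xi:
  "gt_action wt (diag3 (u1, u2, u3)) (\<xi> (a, x, z)) =
    (\<lambda>M. (u1 * of_real a + u2 * of_real (x + z - a) - u3 * of_real (x + z)) * \<xi> (a, x, z) M)"
proof (rule V_eqI[OF gt_action_in_V V_scale[OF gt_xi_in_space]])
  fix a' x' z' assume M: "(a', x', z') \<in> P"
  show "gt_action wt (diag3 (u1, u2, u3)) (\<xi> (a, x, z)) (a', x', z') =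
      (u1 * of_real a + u2 * of_real (x + z - a) - u3 * of_real (x + z)) * \<xi> (a, x, z) (a', x', z')"
    unfolding gt_action_diag3[OF M gt_xi_in_space] by (auto simp: gt_xi_def)
qed

text \<open>The group law carries the derivative at 0 to every s, so each coordinate g satisfies g'
  = k g, and exp(-k s) g(s) has derivative zero. This evaluates the square of \<open>\<tau>\<close>
  in \<open>tau_top\<close>.\<close>

lemma pi_diag_curve_xi:
  fixes a x z :: real and u1 u2 u3 :: complex
  assumes u: "u1 + u2 + u3 = 0"
  defines "k \<equiv> u1 * of_real a + u2 * of_real (x + z - a) - u3 * of_real (x + z)"
  shows "\<pi> (diag_curve u1 u2 u3 s) (\<xi> (a, x, z)) = (\<lambda>M. exp (of_real s * k) * \<xi> (a, x, z) M)"
proof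
  fix M
  note D = diag_curve[OF u]
  let ?v = "\<xi> (a, x, z)" and ?D = "diag_curve u1 u2 u3"
  have v: "?v \<in> V" by (rule gt_xi_in_space)
  define g where "g s = \<pi> (?D s) ?v M" for s
  have "(g has_vector_derivative k * g s) (at s)" for s
  proof -
    have "((\<lambda>t. \<pi> (?D s) (\<pi> (?D t) ?v) M) has_vector_derivative
        \<pi> (?D s) (gt_action wt (diag3 (u1, u2, u3)) ?v) M) (at 0)"
      using D v sl3_members(4)[OF u]
      by (intro pi_has_vector_derivative pi_closed gt_action_in_V pi_deriv)
    moreover have "\<pi> (?D s) (\<pi> (?D t) ?v) M = g (s + t)" for t
      using D v by (simp add: g_def pi_mult)
    moreover have "\<pi> (?D s) (gt_action wt (diag3 (u1, u2, u3)) ?v) M = k * g s"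
      unfolding gt_action_diag3_xi k_def[symmetric] using D v by (simp add: pi_scale g_def)
    ultimately have "((\<lambda>t. g (s + t)) has_vector_derivative k * g s) (at (s - s))"
      by simp
    then have "(g \<circ> (\<lambda>t. s + t) \<circ> (\<lambda>t. t - s) has_vector_derivative 1 *\<^sub>R (k * g s)) (at s)"
      by (intro vector_diff_chain_at) (auto intro!: derivative_eq_intros simp: o_def)
    then show ?thesis by (simp add: o_def)
  qed
  note g = this
  have "((\<lambda>s. exp (of_real s * (- k)) * g s) has_vector_derivative 0) (at s)" for s
  proof -
    have "((\<lambda>s. exp (s * (- k))) has_field_derivative - k * exp (of_real s * (- k))) (at (of_real s))"
      by (auto intro!: derivative_eq_intros)
    from has_vector_derivative_mult[OF has_vector_derivative_real_field[OF this] g]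
    show ?thesis by (rule has_vector_derivative_eq_rhs) (simp add: mult_ac)
  qed
  then obtain c where c: "\<And>s. exp (of_real s * (- k)) * g s = c"
    using has_vector_derivative_zero_constant[of UNIV "\<lambda>s. exp (of_real s * (- k)) * g s"] by auto
  have "c = ?v M" using c[of 0] D(2) pi_one[OF v] by (simp add: g_def)
  then have "exp (of_real s * k) * (exp (of_real s * (- k)) * g s) = exp (of_real s * k) * ?v M"
    using c by simp
  then have "g s = exp (of_real s * k) * ?v M"
    by (simp add: exp_minus mult.assoc[symmetric])
  then show "\<pi> (?D s) ?v M = exp (of_real s * k) * ?v M" by (simp add: g_def)
qed

section \<open>The eigenspace of \<open>e11\<close> for the largest eigenvalue\<close>

lemma xi_apply: "M \<in> P \<Longrightarrow> \<xi> L M = (if M = L then 1 else 0)"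
  by (auto simp: gt_xi_def)

lemma top_in_P: "(l31, l31, c) \<in> P \<longleftrightarrow> l32 - c \<in> \<nat> \<and> c - l33 \<in> \<nat>"
  using Nats_add[OF weight_Nats(1), of "l32 - c"] weight_Nats by (auto simp: gt_patterns.simps)

lemma top_minus: "(l31, l31, c) \<in> P \<Longrightarrow> (l31, l31, l32 + l33 - c) \<in> P"
  by (simp add: top_in_P)

text \<open>The nonzero value in \<open>entry_top\<close>, from \<open>(l31, l31, c)\<close> to
  \<open>(l31, l31, l32 + l33 - c)\<close>.\<close>

definition top_entry :: "real \<Rightarrow> real" where
  "top_entry c = (-1) powi \<lfloor>l32 + l33 - c - l31\<rfloor> * (rfact (c - l33) / rfact (l32 - c))"

lemma top_entry_nonzero: "top_entry c \<noteq> 0"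
  by (simp add: top_entry_def)

text \<open>The recursion that \<open>\<tau> e\<^sub>3\<^sub>2 = - e\<^sub>2\<^sub>3 \<tau>\<close>
  forces, by \<open>e32_top\<close> and \<open>e23_top\<close>.\<close>

lemma top_entry_step:
  assumes "(l31, l31, c) \<in> P" "(l31, l31, c + 1) \<in> P"
  shows "top_entry (c + 1) = - ((l32 - c) * (c + 1 - l33) * top_entry c)"
proof -
  have "(-1 :: real) powi \<lfloor>l32 + l33 - c - l31\<rfloor> = - ((-1) powi \<lfloor>l32 + l33 - (c + 1) - l31\<rfloor>)"
    by (rule minus_one_powi_floor_add_1) simp
  moreover have "rfact (c + 1 - l33) = (c + 1 - l33) * rfact (c - l33)"
    using assms(1) by (intro rfact_add_1) (auto simp: top_in_P)
  moreover have "rfact (l32 - c) = (l32 - c) * rfact (l32 - (c + 1))"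
    using assms(2) by (intro rfact_add_1) (auto simp: top_in_P)
  moreover have "l32 - c \<noteq> 0" using gt_pattern_Nats(9)[OF assms(2)] by auto
  ultimately show ?thesis by (simp add: top_entry_def)
qed

text \<open>As \<open>\<tau>\<close> exchanges the last two diagonal parameters, the image is a
  weight vector, and its weight occurs only at the pattern \<open>(l31, l31, l33)\<close>.\<close>

lemma tau_highest:
  "\<tau> (\<xi> (l31, l31, l32)) = (\<lambda>M. \<tau> (\<xi> (l31, l31, l32)) (l31, l31, l33) * \<xi> (l31, l31, l33) M)"
proof (rule V_eqI)
  let ?v = "\<tau> (\<xi> (l31, l31, l32))"
  show v: "?v \<in> V" by (simp add: tau_closed gt_xi_in_space)
  show "(\<lambda>M. ?v (l31, l31, l33) * \<xi> (l31, l31, l33) M) \<in> V"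
    by (simp add: V_scale gt_xi_in_space)
  fix a x z assume M: "(a, x, z) \<in> P"
  have w: "(u1 * of_real l31 + u2 * of_real (l31 + l32 - l31) - u3 * of_real (l31 + l32)) * ?v (a, x, z) =
      (u1 * of_real a + u3 * of_real (x + z - a) - u2 * of_real (x + z)) * ?v (a, x, z)"
    if "u1 + u2 + u3 = 0" for u1 u2 u3
  proof -
    have "\<tau> (gt_action wt (diag3 (u1, u2, u3)) (\<xi> (l31, l31, l32))) (a, x, z) =
        gt_action wt (diag3 (u1, u3, u2)) ?v (a, x, z)"
      using tau_diag3[OF gt_xi_in_space that] by simp
    then show ?thesis
      unfolding gt_action_diag3_xi gt_action_diag3[OF M v]
      by (simp only: pi_scale[OF SL3_members(2) gt_xi_in_space])
  qed
  show "?v (a, x, z) = ?v (l31, l31, l33) * \<xi> (l31, l31, l33) (a, x, z)"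
  proof (cases "?v (a, x, z) = 0")
    case True
    then show ?thesis using M by (auto simp: xi_apply)
  next
    case False
    note w' = w[unfolded mult_right_cancel[OF False]]
    \<comment> \<open>The diagonal matrix with entries 2, -1, -1 acts as 3 \<open>e11\<close> and
      fixes a, hence x; the one with entries 0, 1, -1 then fixes z.\<close>
    have "complex_of_real (3 * l31) = of_real (3 * a)"
      using w'[of 2 "-1" "-1"] by (simp add: algebra_simps)
    then have a: "a = l31" by (simp only: of_real_eq_iff)
    then have x: "x = l31" using gt_pattern_Nats[OF M] by linarith
    have "complex_of_real (l32 + (l31 + l32)) = of_real (- (x + z - a) - (x + z))"
      using w'[of 0 1 "-1"] by (simp add: algebra_simps)
    then have "z = l33" unfolding of_real_eq_iff using a x weight_sum by simp
    then show ?thesis using M a x by (simp add: xi_apply)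
  qed
qed

text \<open>Within this eigenspace only the last entry can move, and a = x cancels the quotient (a -
  z) / (x - z).\<close>

lemma e32_top:
  assumes "(l31, l31, c) \<in> P" "(l31, l31, c + 1) \<in> P"
  shows "e32 wt (\<xi> (l31, l31, c + 1)) = (\<lambda>M. of_real ((l32 - c) * (c + 1 - l33)) * \<xi> (l31, l31, c) M)"
proof (rule V_eqI[OF e_in_V(7) V_scale[OF gt_xi_in_space]])
  fix a x z assume M: "(a, x, z) \<in> P"
  have "\<xi> (l31, l31, c + 1) (a, x + 1, z) = 0"
    using gt_pattern_Nats(11)[OF M] by (auto simp: gt_xi_def)
  moreover have "\<xi> (l31, l31, c + 1) (a, x, z + 1) = \<xi> (l31, l31, c) (a, x, z)"
    using assms by (auto simp: gt_xi_def)
  moreover have "l31 - c \<noteq> 0" using gt_pattern_Nats[OF assms(2)] by auto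
  ultimately show "e32 wt (\<xi> (l31, l31, c + 1)) (a, x, z) =
      of_real ((l32 - c) * (c + 1 - l33)) * \<xi> (l31, l31, c) (a, x, z)"
    unfolding e32_apply[OF M gt_xi_in_space] by (auto simp: xi_apply[OF M])
qed

lemma e23_top:
  assumes "(l31, l31, c) \<in> P"
  shows "e23 wt (\<xi> (l31, l31, c)) = \<xi> (l31, l31, c + 1)"
proof (rule V_eqI[OF e_in_V(6) gt_xi_in_space])
  fix a x z assume M: "(a, x, z) \<in> P"
  have "\<xi> (l31, l31, c) (a, x - 1, z) = 0"
    using gt_pattern_Nats(7)[OF M] by (auto simp: gt_xi_def)
  moreover have "\<xi> (l31, l31, c) (a, x, z - 1) = \<xi> (l31, l31, c + 1) (a, x, z)"
    using assms M by (auto simp: gt_xi_def)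
  moreover have "l31 - z + 2 \<noteq> 0" using gt_pattern_Nats[OF M] by auto
  ultimately show "e23 wt (\<xi> (l31, l31, c)) (a, x, z) = \<xi> (l31, l31, c + 1) (a, x, z)"
    unfolding e23_apply[OF M gt_xi_in_space] by (auto simp: xi_apply[OF M] simp flip: of_real_add of_real_diff)
qed

lemma minus_one_powi_floor_nat: "(-1 :: real) powi \<lfloor>- real n\<rfloor> = (-1) ^ n"
proof -
  have "\<lfloor>- real n\<rfloor> = - int n" by linarith
  then show ?thesis by (cases "even n") (simp_all add: power_int_minus)
qed

text \<open>The case c = l32 defines \<open>\<kappa>\<close>, and \<open>e32\<close> lowers c step
  by step with the recursion of \<open>top_entry\<close>. Evaluating the square of
  \<open>\<tau>\<close> on the highest weight vector in two ways gives \<kappa> * \<kappa> =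
  1.\<close>

lemma tau_top:
  obtains \<kappa> :: complex where "\<kappa> = 1 \<or> \<kappa> = - 1"
    "\<And>c. (l31, l31, c) \<in> P \<Longrightarrow>
      \<tau> (\<xi> (l31, l31, c)) = (\<lambda>M. \<kappa> * of_real (top_entry c) * \<xi> (l31, l31, l32 + l33 - c) M)"
proof -
  define \<kappa> where "\<kappa> = \<tau> (\<xi> (l31, l31, l32)) (l31, l31, l33) / of_real (top_entry l32)"
  have top: "\<tau> (\<xi> (l31, l31, c)) = (\<lambda>M. \<kappa> * of_real (top_entry c) * \<xi> (l31, l31, l32 + l33 - c) M)"
    if "(l31, l31, c) \<in> P" for c
  proof -
    have "l32 - c \<in> \<nat>" using that by (simp add: top_in_P)
    then obtain k where "l32 - c = real k" by (rule Nats_cases)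
    then show ?thesis using that
    proof (induction k arbitrary: c)
      case 0
      then have "c = l32" by simp
      moreover have "\<kappa> * of_real (top_entry l32) = \<tau> (\<xi> (l31, l31, l32)) (l31, l31, l33)"
        by (simp add: \<kappa>_def top_entry_nonzero)
      ultimately show ?case using tau_highest by simp
    next
      case (Suc k)
      have "l32 - (c + 1) = real k" using Suc.prems(1) by simp
      moreover have "c + 1 - l33 \<in> \<nat>" using gt_pattern_Nats(4)[OF Suc.prems(2)] by (rule Nats_add_1) simp
      ultimately have P1: "(l31, l31, c + 1) \<in> P" unfolding top_in_P by simp
      let ?d = "(l32 - c) * (c + 1 - l33)"
      have d: "?d \<noteq> 0" using gt_pattern_Nats(9)[OF P1] gt_pattern_Nats(10)[OF Suc.prems(2)] by simp
      have IH: "\<tau> (\<xi> (l31, l31, c + 1)) =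
          (\<lambda>M. \<kappa> * of_real (top_entry (c + 1)) * \<xi> (l31, l31, l32 + l33 - (c + 1)) M)"
        using Suc.IH[OF _ P1] Suc.prems(1) by simp
      have "e23 wt (\<tau> (\<xi> (l31, l31, c + 1))) =
         (\<lambda>M. \<kappa> * of_real (top_entry (c + 1)) * e23 wt (\<xi> (l31, l31, l32 + l33 - (c + 1))) M)"
        unfolding IH by (rule V_eqI[OF e_in_V(6) V_scale[OF e_in_V(6)]])
          (simp add: e23_apply V_scale gt_xi_in_space algebra_simps)
      also have "e23 wt (\<xi> (l31, l31, l32 + l33 - (c + 1))) = \<xi> (l31, l31, l32 + l33 - c)"
        using e23_top[OF top_minus[OF P1]] by (simp add: algebra_simps)
      finally have eq: "(\<lambda>M. of_real ?d * \<tau> (\<xi> (l31, l31, c)) M) =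
         (\<lambda>M. - (\<kappa> * of_real (top_entry (c + 1)) * \<xi> (l31, l31, l32 + l33 - c) M))"
        using tau_intertwine(3)[OF gt_xi_in_space, of "(l31, l31, c + 1)"]
        unfolding e32_top[OF Suc.prems(2) P1] by (simp only: pi_scale[OF SL3_members(2) gt_xi_in_space])
      have "of_real ?d * \<tau> (\<xi> (l31, l31, c)) M =
          of_real ?d * (\<kappa> * of_real (top_entry c) * \<xi> (l31, l31, l32 + l33 - c) M)" for M
        using fun_cong[OF eq, of M] unfolding top_entry_step[OF Suc.prems(2) P1] by (simp add: mult_ac)
      then show ?case using d by (intro ext) (simp only: mult_cancel_left of_real_eq_0_iff if_False simp_thms)
    qed
  qed
  have P: "(l31, l31, l32) \<in> P" "(l31, l31, l33) \<in> P"
    using weight_Nats by (auto simp: top_in_P)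
  let ?v = "\<xi> (l31, l31, l32)"
  obtain p q where pq: "l31 - l32 = real p" "l32 - l33 = real q"
    using weight_Nats by (metis Nats_cases)
  have "\<tau> (\<tau> ?v) = (\<lambda>M. \<kappa> * of_real (top_entry l32) * \<tau> (\<xi> (l31, l31, l33)) M)"
    unfolding top[OF P(1)] by (simp add: pi_scale SL3_members gt_xi_in_space)
  then have 1: "\<tau> (\<tau> ?v) (l31, l31, l32) = \<kappa> * of_real (top_entry l32) * (\<kappa> * of_real (top_entry l33))"
    unfolding top[OF P(2)] using P by (simp add: xi_apply)
  \<comment> \<open>Both sides are the diagonal matrix with entries 1, -1, -1, since exp(\<i> pi) =
    exp(-\<i> pi) = -1. So the square of \<open>\<tau>\<close> acts on \<open>?v\<close> by the
    scalar of \<open>pi_diag_curve_xi\<close>.\<close>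
  have "T_rot_inv ** T_rot_inv = diag_curve 0 \<i> (- \<i>) pi"
    by (simp add: diag_curve_def mat3_simps exp_minus mult.commute)
  then have "\<tau> (\<tau> ?v) = \<pi> (diag_curve 0 \<i> (- \<i>) pi) ?v"
    by (simp add: pi_mult[symmetric] SL3_members gt_xi_in_space)
  then have "\<tau> (\<tau> ?v) (l31, l31, l32) = exp (of_real pi * (\<i> * of_real (l31 + l32 - l31) + \<i> * of_real (l31 + l32)))"
    using P by (simp add: pi_diag_curve_xi xi_apply)
  also have "of_real pi * (\<i> * of_real (l31 + l32 - l31) + \<i> * of_real (l31 + l32)) =
     \<i> * of_real pi * of_real (l31 + l32 - l31 + (l31 + l32))"
    by (simp add: algebra_simps)
  also have "l31 + l32 - l31 + (l31 + l32) = real q" using weight_sum pq by simp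
  also have "exp (\<i> * of_real pi * of_real (real q)) = (-1) ^ q"
    by (simp add: exp_of_nat2_mult)
  finally have 2: "\<tau> (\<tau> ?v) (l31, l31, l32) = (-1) ^ q" .
  have "l32 + l33 - l32 - l31 = - real (p + q)" "l32 + l33 - l33 - l31 = - real p"
    using pq by simp_all
  \<comment> \<open>The factorial quotients at l32 and l33 are inverse to each other; only the signs
    remain.\<close>
  then have "top_entry l32 * top_entry l33 = (-1) ^ (p + q) * (-1) ^ p"
    unfolding top_entry_def by (simp only: minus_one_powi_floor_nat) simp
  also have "\<dots> = (-1) ^ q" by (simp add: power_add)
  finally have "complex_of_real (top_entry l32) * of_real (top_entry l33) = (-1) ^ q"
    by (simp flip: of_real_mult)
  then have "\<kappa> * \<kappa> * (-1) ^ q = (-1) ^ q"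
    using 1 2 by (simp add: mult_ac)
  then have "\<kappa> * \<kappa> = 1" by simp
  then have "\<kappa> = 1 \<or> \<kappa> = - 1" by (simp add: square_eq_1_iff)
  then show ?thesis using top by (rule that)
qed

section \<open>Descending induction on the first entry\<close>

definition S_vec :: "pattern \<Rightarrow> gtvec" where
  "S_vec L = (\<lambda>M. if M \<in> P then of_real (S L M) else 0)"

lemma S_vec_in_V: "S_vec L \<in> V"
  by (simp add: S_vec_def gt_space_def)

lemma tau_lower:
  assumes L: "(a, b, c) \<in> P" "(a + 1, b, c) \<in> P"
    and tau: "\<tau> (\<xi> (a + 1, b, c)) = (\<lambda>M. \<kappa> * S_vec (a + 1, b, c) M)"
  shows "\<tau> (\<xi> (a, b, c)) = (\<lambda>M. \<kappa> * S_vec (a, b, c) M)"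
proof (rule V_eqI[OF tau_closed[OF gt_xi_in_space] V_scale[OF S_vec_in_V]])
  have "e21 wt (\<xi> (a + 1, b, c)) = \<xi> (a, b, c)"
  proof (rule V_eqI[OF e_in_V(5) gt_xi_in_space])
    fix a' x z assume M: "(a', x, z) \<in> P"
    show "e21 wt (\<xi> (a + 1, b, c)) (a', x, z) = \<xi> (a, b, c) (a', x, z)"
      unfolding e21_apply[OF M gt_xi_in_space] using L by (auto simp: gt_xi_def)
  qed
  then have *: "\<tau> (\<xi> (a, b, c)) = e31 wt (\<lambda>M. \<kappa> * S_vec (a + 1, b, c) M)"
    using tau_intertwine(1)[OF gt_xi_in_space, of "(a + 1, b, c)"] tau by simp
  fix a' x z assume M: "(a', x, z) \<in> P"
  let ?C = "(x + 1 - l32) * (x + 2 - l33) / (x - z + 2)"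
  let ?D = "(l32 - z) * (z + 1 - l33) / (x - z)"
  have "of_real ?C * S_vec (a + 1, b, c) (a' + 1, x + 1, z) - of_real ?D * S_vec (a + 1, b, c) (a' + 1, x, z + 1) =
      S_vec (a, b, c) (a', x, z)"
  proof (cases "a' = a")
    case True
    have "complex_of_real (S (a, b, c) (a, x, z)) =
      of_real (?C * (if (a + 1, x + 1, z) \<in> P then S (a + 1, b, c) (a + 1, x + 1, z) else 0)
       - ?D * (if (a + 1, x, z + 1) \<in> P then S (a + 1, b, c) (a + 1, x, z + 1) else 0))"
      using entry_lower[OF L(2)] M True by simp
    then show ?thesis using M True unfolding S_vec_def of_real_diff of_real_mult[of ?C] of_real_mult[of ?D]
      by (simp only: if_True if_distrib[of complex_of_real] of_real_0)
  qed (simp add: S_vec_def gt_rotation_entry.simps)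
  from arg_cong[OF this, of "\<lambda>u. \<kappa> * u"]
  show "\<tau> (\<xi> (a, b, c)) (a', x, z) = \<kappa> * S_vec (a, b, c) (a', x, z)"
    unfolding * e31_apply[OF M V_scale[OF S_vec_in_V]]
    by (simp only: right_diff_distrib mult.left_commute)
qed

text \<open>Applying \<open>e31\<close> to the vector of \<open>(a + 1, a + 1, c)\<close> gives a
  combination of the vectors of \<open>(a, a, c)\<close> and \<open>(a, a + 1, c - 1)\<close>. The
  first coefficient is nonzero, so the intertwining relation can be solved for the image of the
  first vector.\<close>

lemma tau_raise:
  assumes L: "(a, a, c) \<in> P" "(a + 1, a + 1, c) \<in> P"
    and tau: "\<tau> (\<xi> (a + 1, a + 1, c)) = (\<lambda>M. \<kappa> * S_vec (a + 1, a + 1, c) M)"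
    and tau': "(a, a + 1, c - 1) \<in> P \<Longrightarrow> \<tau> (\<xi> (a, a + 1, c - 1)) = (\<lambda>M. \<kappa> * S_vec (a, a + 1, c - 1) M)"
  shows "\<tau> (\<xi> (a, a, c)) = (\<lambda>M. \<kappa> * S_vec (a, a, c) M)"
proof (rule V_eqI[OF tau_closed[OF gt_xi_in_space] V_scale[OF S_vec_in_V]])
  define C where "C = (a + 1 - l32) * (a + 2 - l33) / (a + 2 - c)"
  define D where "D = (l32 - c + 1) * (c - l33) / (a + 2 - c)"
  note N = gt_pattern_Nats[OF L(1)]
  \<comment> \<open>All three factors are positive, since a \<ge> l32 \<ge> l33 and a \<ge>
    c.\<close>
  have C: "C \<noteq> 0" using N by (simp add: C_def)
  have "e31 wt (\<xi> (a + 1, a + 1, c)) = (\<lambda>M. of_real C * \<xi> (a, a, c) M + of_real (- D) * \<xi> (a, a + 1, c - 1) M)"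
  proof (rule V_eqI)
    show "(\<lambda>M. of_real C * \<xi> (a, a, c) M + of_real (- D) * \<xi> (a, a + 1, c - 1) M) \<in> V"
      by (simp add: gt_space_def gt_xi_def)
    fix a' x z assume M: "(a', x, z) \<in> P"
    have "\<xi> (a + 1, a + 1, c) (a' + 1, x + 1, z) = \<xi> (a, a, c) (a', x, z)"
      "\<xi> (a + 1, a + 1, c) (a' + 1, x, z + 1) = \<xi> (a, a + 1, c - 1) (a', x, z)"
      using L M by (auto simp: gt_xi_def)
    then show "e31 wt (\<xi> (a + 1, a + 1, c)) (a', x, z) =
       of_real C * \<xi> (a, a, c) (a', x, z) + of_real (- D) * \<xi> (a, a + 1, c - 1) (a', x, z)"
      unfolding e31_apply[OF M gt_xi_in_space] using M
      by (auto simp: xi_apply C_def D_def algebra_simps)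
  qed (rule e13_e31_in_V)
  from arg_cong[OF this, of \<tau>]
  have "(\<lambda>M. - e21 wt (\<lambda>M. \<kappa> * S_vec (a + 1, a + 1, c) M) M) =
     (\<lambda>M. of_real C * \<tau> (\<xi> (a, a, c)) M + of_real (- D) * \<tau> (\<xi> (a, a + 1, c - 1)) M)"
    unfolding tau_intertwine(2)[OF gt_xi_in_space] tau pi_lin[OF SL3_members(2) gt_xi_in_space gt_xi_in_space] .
  from fun_cong[OF this]
  have *: "of_real C * \<tau> (\<xi> (a, a, c)) M - of_real D * \<tau> (\<xi> (a, a + 1, c - 1)) M =
      - e21 wt (\<lambda>M. \<kappa> * S_vec (a + 1, a + 1, c) M) M" for M
    by simp
  \<comment> \<open>If the triple is not a pattern, its basis vector is zero by convention and
    linearity makes the image zero.\<close>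
  have tau'': "\<tau> (\<xi> (a, a + 1, c - 1)) M =
      \<kappa> * (if (a, a + 1, c - 1) \<in> P then S_vec (a, a + 1, c - 1) M else 0)" for M
  proof (cases "(a, a + 1, c - 1) \<in> P")
    case False
    then have "\<xi> (a, a + 1, c - 1) = (\<lambda>M. 0 * \<xi> (a, a, c) M)" by (auto simp: gt_xi_def)
    then show ?thesis using False pi_scale[OF SL3_members(2) gt_xi_in_space, of 0 wt] by simp
  qed (simp add: tau')
  fix a' x z assume M: "(a', x, z) \<in> P"
  have "of_real C * S_vec (a, a, c) (a', x, z)
     - of_real D * (if (a, a + 1, c - 1) \<in> P then S_vec (a, a + 1, c - 1) (a', x, z) else 0) =
     - S_vec (a + 1, a + 1, c) (a' + 1, x, z)"
  proof (cases "a' = a")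
    case True
    have "complex_of_real (C * S (a, a, c) (a, x, z)
      - D * (if (a, a + 1, c - 1) \<in> P then S (a, a + 1, c - 1) (a, x, z) else 0)) =
      of_real (- (if (a + 1, x, z) \<in> P then S (a + 1, a + 1, c) (a + 1, x, z) else 0))"
      using entry_raise[OF L(2,1)] M True unfolding C_def D_def by simp
    then show ?thesis using M True unfolding S_vec_def of_real_diff of_real_mult of_real_minus
      by (simp only: if_True if_distrib[of complex_of_real] of_real_0)
  qed (simp add: S_vec_def gt_rotation_entry.simps)
  from arg_cong[OF this, of "\<lambda>u. \<kappa> * u"]
  have "of_real C * \<tau> (\<xi> (a, a, c)) (a', x, z)
      - of_real D * (\<kappa> * (if (a, a + 1, c - 1) \<in> P then S_vec (a, a + 1, c - 1) (a', x, z) else 0)) =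
    of_real C * (\<kappa> * S_vec (a, a, c) (a', x, z))
      - of_real D * (\<kappa> * (if (a, a + 1, c - 1) \<in> P then S_vec (a, a + 1, c - 1) (a', x, z) else 0))"
    using *[of "(a', x, z)"]
    unfolding tau'' e21_apply[OF M V_scale[OF S_vec_in_V]]
    by (simp only: right_diff_distrib mult_minus_right mult.left_commute)
  then have "of_real C * \<tau> (\<xi> (a, a, c)) (a', x, z) = of_real C * (\<kappa> * S_vec (a, a, c) (a', x, z))"
    by simp
  then show "\<tau> (\<xi> (a, a, c)) (a', x, z) = \<kappa> * S_vec (a, a, c) (a', x, z)"
    using C by simp
qed

text \<open>Induction on l31 - a, starting from \<open>tau_top\<close>. For given a, the patterns
  with b different from a come first, by \<open>tau_lower\<close>; those with b = a follow by
  \<open>tau_raise\<close>, which needs the first kind at the same a.\<close>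

lemma tau_eq:
  obtains \<kappa> :: complex where "\<kappa> = 1 \<or> \<kappa> = - 1"
    "\<And>L. L \<in> P \<Longrightarrow> \<tau> (\<xi> L) = (\<lambda>M. \<kappa> * S_vec L M)"
proof -
  obtain \<kappa> :: complex where \<kappa>: "\<kappa> = 1 \<or> \<kappa> = - 1"
    and top: "\<And>c. (l31, l31, c) \<in> P \<Longrightarrow>
      \<tau> (\<xi> (l31, l31, c)) = (\<lambda>M. \<kappa> * of_real (top_entry c) * \<xi> (l31, l31, l32 + l33 - c) M)"
    by (rule tau_top) blast
  have "\<tau> (\<xi> (a, b, c)) = (\<lambda>M. \<kappa> * S_vec (a, b, c) M)" if "(a, b, c) \<in> P" for a b c
  proof -
    have "l31 - a \<in> \<nat>" using gt_pattern_Nats(14)[OF that] .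
    then obtain n where "l31 - a = real n" by (rule Nats_cases)
    then show ?thesis using that
    proof (induction n arbitrary: a b c)
      case 0
      have ab: "a = l31" "b = l31" using 0 gt_pattern_Nats[OF 0(2)] by simp_all
      show ?case unfolding ab
      proof (rule V_eqI[OF tau_closed[OF gt_xi_in_space] V_scale[OF S_vec_in_V]])
        fix a' x z assume M: "(a', x, z) \<in> P"
        have P: "(l31, l31, c) \<in> P" using 0(2) ab by simp
        show "\<tau> (\<xi> (l31, l31, c)) (a', x, z) = \<kappa> * S_vec (l31, l31, c) (a', x, z)"
        proof (cases "a' = l31")
          case True
          then show ?thesis
            using entry_top[OF P] M
            by (auto simp: top[OF P] xi_apply S_vec_def top_entry_def)
        next
          case False
          then show ?thesis
            using M by (simp add: top[OF P] xi_apply S_vec_def gt_rotation_entry.simps)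
        qed
      qed
    next
      case (Suc n)
      have n: "l31 - (a + 1) = real n" using Suc.prems(1) by simp
      \<comment> \<open>Stated for arbitrary b and c, because the case a = b uses it at
        \<open>(a, a + 1, c - 1)\<close>.\<close>
      have lower: "\<tau> (\<xi> (a, b, c)) = (\<lambda>M. \<kappa> * S_vec (a, b, c) M)"
        if P: "(a, b, c) \<in> P" and "a \<noteq> b" for b c
      proof (rule tau_lower[OF P])
        show P1: "(a + 1, b, c) \<in> P"
          using gt_pattern_Nats[OF P] that(2) Nats_minus_1[OF gt_pattern_Nats(5)[OF P], of "b - (a + 1)"]
            Nats_add_1[OF gt_pattern_Nats(6)[OF P], of "a + 1 - c"]
          by (simp add: gt_patterns.simps)
        show "\<tau> (\<xi> (a + 1, b, c)) = (\<lambda>M. \<kappa> * S_vec (a + 1, b, c) M)"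
          by (rule Suc.IH[OF n P1])
      qed
      show ?case
      proof (cases "a = b")
        case False
        then show ?thesis using lower Suc.prems(2) by blast
      next
        case True
        then have P: "(a, a, c) \<in> P" using Suc.prems(2) by simp
        \<comment> \<open>The upper bound a + 1 \<le> l31 holds because l31 - (a + 1) is the natural
          number n.\<close>
        have P1: "(a + 1, a + 1, c) \<in> P"
          using gt_pattern_Nats[OF P] n Nats_add_1[OF gt_pattern_Nats(2)[OF P], of "a + 1 - l32"]
            Nats_add_1[OF gt_pattern_Nats(6)[OF P], of "a + 1 - c"]
          by (simp add: gt_patterns.simps)
        have "\<tau> (\<xi> (a, a, c)) = (\<lambda>M. \<kappa> * S_vec (a, a, c) M)"
          by (rule tau_raise[OF P P1 Suc.IH[OF n P1] lower]) auto
        then show ?thesis using True by simp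
      qed
    qed
  qed
  then show ?thesis using \<kappa> that by (metis prod_cases3)
qed

end

section \<open>The matrix elements of the rotation\<close>

theorem proposition5p1:
  fixes l31 l32 l33 :: real
    and \<pi> :: "complex^3^3 \<Rightarrow> gtvec \<Rightarrow> gtvec"
    and \<tau> :: "gtvec \<Rightarrow> gtvec"
    and \<tau>m :: "pattern \<Rightarrow> pattern \<Rightarrow> complex"
  assumes weight: "highest_weight (l31, l32, l33)"
    and rep: "integrates_gt_action (l31, l32, l33) \<pi>"
    and tau: "\<tau> = \<pi> (matrix_inv T_rot)"
    and matrix_elements: "\<And>L. L \<in> gt_patterns (l31, l32, l33) \<Longrightarrow>
      \<tau> (gt_xi (l31, l32, l33) L) =
        (\<lambda>M. \<Sum>L'\<in>gt_patterns (l31, l32, l33). \<tau>m L' L * gt_xi (l31, l32, l33) L' M)"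
  shows "\<exists>\<epsilon>\<in>{1, -1 :: real}.
    \<forall>l11 l21 l22 l11' l21' l22'.
      (l11, l21, l22) \<in> gt_patterns (l31, l32, l33) \<longrightarrow>
      (l11', l21', l22') \<in> gt_patterns (l31, l32, l33) \<longrightarrow>
      \<tau>m (l11', l21', l22') (l11, l21, l22) =
        of_real (\<epsilon> *
          (if l11' = l11 \<and> l21 + l22 = l11' - l21' - l22' then
             t_coeff (l31, l32, l33) l21' l11' l22' *
             (-1) powi \<lfloor>l22' - l21\<rfloor> *
             racah_R (l31 - l21) (l31 - l21')
               (l32 - l31 - 1) (l21 + l22 + l33 - 1) (l11 - l31 - 1) (- l21 - l22 - l31 - 1)
           else 0))"
proof -
  interpret gt_integrated l31 l32 l33 \<pi>
    using weight rep by unfold_locales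
  obtain \<kappa> :: complex where \<kappa>: "\<kappa> = 1 \<or> \<kappa> = - 1"
    and eq: "\<And>L. L \<in> P \<Longrightarrow> \<pi> T_rot_inv (\<xi> L) = (\<lambda>M. \<kappa> * S_vec L M)"
    by (rule tau_eq) blast
  have "\<kappa> = of_real (Re \<kappa>)" "Re \<kappa> \<in> {1, -1}" using \<kappa> by auto
  \<comment> \<open>Evaluating the expansion of the image of \<xi> \<open>L\<close> at the pattern
    \<open>M\<close> isolates a single matrix element.\<close>
  moreover have "\<tau>m M L = \<kappa> * of_real (S L M)" if L: "L \<in> P" and M: "M \<in> P" for L M
  proof -
    have "\<tau>m M L = (\<Sum>L'\<in>P. \<tau>m L' L * \<xi> L' M)"
      using M by (simp add: xi_apply if_distrib finite_gt_patterns cong: if_cong)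
    also have "\<dots> = \<tau> (\<xi> L) M" using matrix_elements[OF L] by simp
    finally show ?thesis
      using eq[OF L] M by (simp add: tau matrix_inv_T_rot S_vec_def)
  qed
  ultimately have "\<tau>m M L = of_real (Re \<kappa> * S L M)" if "L \<in> P" "M \<in> P" for L M
    using that by (metis of_real_mult)
  then show ?thesis
    unfolding gt_rotation_entry.simps[symmetric] using \<open>Re \<kappa> \<in> {1, -1}\<close> by blast
qed

end
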